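(* For a permutation $\pi$ of $\{1,\dots,r\}$ let $m^\pi\in\mathbb{Z}^r$ be the vector $$m^\pi_k=-l_k+d_k\sum_{j:\,\pi(j)\ge\pi(k)}l_j,\qquad k=1,\dots,r.$$ Let $m\in\mathbb{Z}^r$. Then $m$ yields a pure Bézout and generically surjective formula if and only if $m=m^\pi$ for some permutation $\pi$ of $\{1,\dots,r\}$ and all defects $\delta_1,\dots,\delta_r$ are zero.
   Context: Let $r\ge 1$ and let $l=(l_1,\dots,l_r)$, $d=(d_1,\dots,d_r)$ be vectors of positive integers; put $n=\sum_{k=1}^r l_k$. Let $X=\mathbb{P}^{l_1}\times\cdots\times\mathbb{P}^{l_r}$ over an algebraically closed field of characteristic zero. For $a\in\mathbb{Z}^r$, $H^q(X,a)$ denotes the $q$-th cohomology of the sheaf $\mathcal{O}_X(a_1,\dots,a_r)$. By the Künneth and Bott formulae, $H^q(X,a)=\bigoplus\bigotimes_{k}H^{j_k}(\mathbb{P}^{l_k},a_k)$ (sum over $j_k\in\{0,l_k\}$ with $\sum_k j_k=q$), where $H^0(\mathbb{P}^{l_k},a_k)\ne0\iff a_k\ge0$ and $H^{l_k}(\mathbb{P}^{l_k},a_k)\neq0\iff a_k<-l_k$. For a degree vector $m\in\mathbb{Z}^r$ and $\nu\in\mathbb{Z}$, the $\nu$-th term of the Weyman complex is $K_\nu(m)=\bigoplus_{p=0}^{n+1}H^{p-\nu}(X,m-pd)^{\binom{n+1}{p}}$. The vector $m$ yields a pure Bézout (and generically surjective) formula if its Weyman complex is of pure Bézout type: $K_{-1}(m)=0$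 (this is the condition making the map $K_1(m)\to K_0(m)$ generically surjective), $K_1(m)=H^{n}(X,m-(n+1)d)$ and $K_0(m)=H^0(X,m)$ (all other summands of $K_1(m)$, $K_0(m)$ vanish), these two groups being nonzero. No condition on $K_2(m)$ is imposed. The defect vector $\delta\in\mathbb{Z}^r$ is $\delta_k=l_k-\lceil l_k/d_k\rceil$. *)

theory Defs
  imports
    "HOL-Library.Poly_Mapping"
    "HOL-Library.FuncSet"
    "HOL-Combinatorics.Permutations"
    "HOL-Computational_Algebra.Polynomial"
    "HOL-Algebra.Elementary_Groups"
    "HOL-Algebra.Product_Groups"
begin

text \<open>
  Sheaf cohomology on \<open>X = P^(l 1) \<times> \<dots> \<times> P^(l r)\<close> is defined as Cech cohomology with respect to
  the standard affine cover. As \<open>X\<close> is separated, the cover is affine and \<open>O(a)\<close> is quasi-coherent,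
  this computes the cohomology of \<open>O(a)\<close>.

  The pair \<open>(k, i)\<close> with \<open>i \<le> l k\<close> stands for the homogeneous coordinate \<open>x_(k,i)\<close> of the \<open>k\<close>-th
  factor. Laurent polynomials are elements of the monoid algebra of exponent vectors.
  Vectors \<open>(v_1, \<dots>, v_r)\<close> are functions on \<^typ>\<open>nat\<close> of which only the values on \<open>{1..r}\<close> matter.
\<close>

type_synonym 'k laurent = "(nat \<times> nat \<Rightarrow>\<^sub>0 int) \<Rightarrow>\<^sub>0 'k"

text \<open>The chart \<open>s\<close> is the affine open set where \<open>x_(k, s k) \<noteq> 0\<close> for all \<open>k\<close>.\<close>

definition charts :: "nat \<Rightarrow> (nat \<Rightarrow> nat) \<Rightarrow> (nat \<Rightarrow> nat) set" where
  "charts r l = (\<Pi>\<^sub>E k\<in>{1..r}. {..l k})"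

text \<open>
  The sections of \<open>O(a)\<close> over the intersection of the charts in \<open>S\<close>: the part of multidegree \<open>a\<close> of
  the localization of the polynomial ring in the coordinates at all \<open>x_(k, s k)\<close> with \<open>s \<in> S\<close>.
\<close>

definition sections ::
    "nat \<Rightarrow> (nat \<Rightarrow> nat) \<Rightarrow> (nat \<Rightarrow> int) \<Rightarrow> (nat \<Rightarrow> nat) set \<Rightarrow> 'k::field laurent set" where
  "sections r l a S =
    {f. \<forall>e\<in>Poly_Mapping.keys f.
          Poly_Mapping.keys e \<subseteq> (SIGMA k:{1..r}. {..l k}) \<and>
          (\<forall>k\<in>{1..r}. (\<Sum>i\<le>l k. Poly_Mapping.lookup e (k, i)) = a k) \<and>
          (\<forall>k\<in>{1..r}. \<forall>i\<le>l k. i \<notin> (\<lambda>s. s k) ` S \<longrightarrow> Poly_Mapping.lookup e (k, i) \<ge> 0)}"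

text \<open>
  Cochains are indexed by all nonempty tuples of charts, not only by the strictly increasing ones;
  both complexes have the same cohomology. Degrees are integers, and there are no simplices, hence
  only the zero cochain, in negative degrees. Cochains vanish outside the simplices of their degree.
\<close>

definition simplices :: "nat \<Rightarrow> (nat \<Rightarrow> nat) \<Rightarrow> int \<Rightarrow> (nat \<Rightarrow> nat) list set" where
  "simplices r l q = {\<sigma>. \<sigma> \<noteq> [] \<and> int (length \<sigma>) = q + 1 \<and> set \<sigma> \<subseteq> charts r l}"

definition cochains ::
    "nat \<Rightarrow> (nat \<Rightarrow> nat) \<Rightarrow> (nat \<Rightarrow> int) \<Rightarrow> int \<Rightarrow> ((nat \<Rightarrow> nat) list \<Rightarrow> 'k::field laurent) set" where
  "cochains r l a q =
    {f. (\<forall>\<sigma>\<in>simplices r l q. f \<sigma> \<in> sections r l a (set \<sigma>)) \<and>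
        (\<forall>\<sigma>. \<sigma> \<notin> simplices r l q \<longrightarrow> f \<sigma> = 0)}"

text \<open>\<open>coboundary r l q\<close> is the differential from degree \<open>q\<close> to degree \<open>q + 1\<close>.\<close>

definition coboundary ::
    "nat \<Rightarrow> (nat \<Rightarrow> nat) \<Rightarrow> int \<Rightarrow> ((nat \<Rightarrow> nat) list \<Rightarrow> 'k::field laurent)
      \<Rightarrow> (nat \<Rightarrow> nat) list \<Rightarrow> 'k laurent" where
  "coboundary r l q f \<sigma> =
    (if \<sigma> \<in> simplices r l (q + 1)
     then \<Sum>i<length \<sigma>. (- 1) ^ i * f (take i \<sigma> @ drop (Suc i) \<sigma>)
     else 0)"

definition cocycle_group ::
    "nat \<Rightarrow> (nat \<Rightarrow> nat) \<Rightarrow> (nat \<Rightarrow> int) \<Rightarrow> int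
      \<Rightarrow> ((nat \<Rightarrow> nat) list \<Rightarrow> 'k::field laurent) monoid" where
  "cocycle_group r l a q =
    \<lparr>carrier = {f \<in> cochains r l a q. coboundary r l q f = (\<lambda>_. 0)},
     monoid.mult = (\<lambda>f g \<sigma>. f \<sigma> + g \<sigma>),
     one = (\<lambda>_. 0)\<rparr>"

text \<open>The additive group of \<open>H^q(X, a)\<close>.\<close>

definition cohomology ::
    "nat \<Rightarrow> (nat \<Rightarrow> nat) \<Rightarrow> int \<Rightarrow> (nat \<Rightarrow> int)
      \<Rightarrow> ((nat \<Rightarrow> nat) list \<Rightarrow> 'k::field laurent) set monoid" where
  "cohomology r l q a =
    cocycle_group r l a q Mod (coboundary r l (q - 1) ` cochains r l a (q - 1))"

definition dim_X :: "nat \<Rightarrow> (nat \<Rightarrow> nat) \<Rightarrow> nat" where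
  "dim_X r l = (\<Sum>k=1..r. l k)"

definition weyman_summand ::
    "nat \<Rightarrow> (nat \<Rightarrow> nat) \<Rightarrow> (nat \<Rightarrow> nat) \<Rightarrow> (nat \<Rightarrow> int) \<Rightarrow> int \<Rightarrow> nat
      \<Rightarrow> ((nat \<Rightarrow> nat) list \<Rightarrow> 'k::field laurent) set monoid" where
  "weyman_summand r l d m \<nu> p = cohomology r l (int p - \<nu>) (\<lambda>k. m k - int p * int (d k))"

text \<open>The index \<open>(p, i)\<close> stands for the \<open>i\<close>-th of the \<open>(n + 1) choose p\<close> copies of the \<open>p\<close>-th summand.\<close>

definition weyman_term ::
    "nat \<Rightarrow> (nat \<Rightarrow> nat) \<Rightarrow> (nat \<Rightarrow> nat) \<Rightarrow> (nat \<Rightarrow> int) \<Rightarrow> int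
      \<Rightarrow> (nat \<times> nat \<Rightarrow> ((nat \<Rightarrow> nat) list \<Rightarrow> 'k::field laurent) set) monoid" where
  "weyman_term r l d m \<nu> =
    sum_group (SIGMA p:{..dim_X r l + 1}. {..<(dim_X r l + 1) choose p})
      (\<lambda>(p, i). weyman_summand r l d m \<nu> p)"

text \<open>
  The \<open>p\<close>-th summand is the only one that may contribute to the \<open>\<nu>\<close>-th term. For \<open>p = 0\<close> and
  \<open>p = n + 1\<close> it occurs with multiplicity one, so that the term is then equal to it.
\<close>

definition weyman_term_reduces_to ::
    "'k::field itself \<Rightarrow> nat \<Rightarrow> (nat \<Rightarrow> nat) \<Rightarrow> (nat \<Rightarrow> nat) \<Rightarrow> (nat \<Rightarrow> int) \<Rightarrow> int \<Rightarrow> nat \<Rightarrow> bool" where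
  "weyman_term_reduces_to _ r l d m \<nu> p \<longleftrightarrow>
    (\<forall>p'\<le>dim_X r l + 1. p' \<noteq> p \<longrightarrow>
      trivial_group (weyman_summand r l d m \<nu> p' ::
        ((nat \<Rightarrow> nat) list \<Rightarrow> 'k laurent) set monoid))"

text \<open>
  The first conjunct is the condition \<open>K_(-1)(m) = 0\<close> of generic surjectivity; the others say
  \<open>K_1(m) = H^n(X, m - (n + 1) d) \<noteq> 0\<close> and \<open>K_0(m) = H^0(X, m) \<noteq> 0\<close>.
\<close>

definition pure_bezout_generically_surjective ::
    "'k::field itself \<Rightarrow> nat \<Rightarrow> (nat \<Rightarrow> nat) \<Rightarrow> (nat \<Rightarrow> nat) \<Rightarrow> (nat \<Rightarrow> int) \<Rightarrow> bool" where
  "pure_bezout_generically_surjective K r l d m \<longleftrightarrow>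
    trivial_group (weyman_term r l d m (- 1) ::
      (nat \<times> nat \<Rightarrow> ((nat \<Rightarrow> nat) list \<Rightarrow> 'k laurent) set) monoid) \<and>
    weyman_term_reduces_to K r l d m 1 (dim_X r l + 1) \<and>
    \<not> trivial_group (weyman_term r l d m 1 ::
      (nat \<times> nat \<Rightarrow> ((nat \<Rightarrow> nat) list \<Rightarrow> 'k laurent) set) monoid) \<and>
    weyman_term_reduces_to K r l d m 0 0 \<and>
    \<not> trivial_group (weyman_term r l d m 0 ::
      (nat \<times> nat \<Rightarrow> ((nat \<Rightarrow> nat) list \<Rightarrow> 'k laurent) set) monoid)"

definition defect :: "(nat \<Rightarrow> nat) \<Rightarrow> (nat \<Rightarrow> nat) \<Rightarrow> nat \<Rightarrow> int" where
  "defect l d k = int (l k) - \<lceil>real (l k) / real (d k)\<rceil>"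

definition m_perm ::
    "nat \<Rightarrow> (nat \<Rightarrow> nat) \<Rightarrow> (nat \<Rightarrow> nat) \<Rightarrow> (nat \<Rightarrow> nat) \<Rightarrow> nat \<Rightarrow> int" where
  "m_perm r l d \<pi> k = - int (l k) + int (d k) * (\<Sum>j | j \<in> {1..r} \<and> \<pi> j \<ge> \<pi> k. int (l j))"

end

theory Submission
  imports Defs
begin

text \<open>
  The Cech complex of \<open>O(a)\<close> splits over the exponent vectors \<open>e\<close> of multidegree \<open>a\<close>: the part of
  exponent \<open>e\<close> consists of the scalar cochains on those tuples of charts that meet \<open>{s. s k = i}\<close> for
  every coordinate \<open>(k, i)\<close> with \<open>e (k, i) < 0\<close>. Removing these conditions one at a time through the
  long exact sequence shows that this part is exact unless in every factor all coordinates of \<open>e\<close> are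
  negative or none is, in which case the only cohomology sits in degree \<open>\<Sum> l k\<close> over the
  factors of the first kind. This is the Kuenneth and Bott description of \<open>H^q(X, a)\<close>.

  Hence the \<open>p\<close>-th summand of the \<open>\<nu>\<close>-th term is nonzero iff \<open>p\<close> lies in none of the intervals
  \<open>(\<alpha> k, \<beta> k]\<close> with \<open>\<alpha> k = \<lfloor>m k / d k\<rfloor>\<close>, \<open>\<beta> k = \<lfloor>(m k + l k) / d k\<rfloor>\<close>, and \<open>p - \<nu> = s p\<close> where
  \<open>s p = \<Sum> l k\<close> over \<open>\<alpha> k < p\<close>. Each interval has at most \<open>l k\<close> points, so \<open>s p - p\<close> drops by at
  most one between consecutive uncovered \<open>p\<close>. Since it would have to avoid \<open>-1, 0, 1\<close> on the way
  from \<open>0\<close> at \<open>p = 0\<close> to \<open>-1\<close> at \<open>p = n + 1\<close>, there is no uncovered \<open>p\<close> in between. By counting,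
  the intervals then tile \<open>{1..n}\<close> with exact lengths \<open>l k\<close>, which forces zero defects, and their order
  from left to right is the permutation.
\<close>

section \<open>Cochains on tuples of points\<close>

text \<open>The Cech coboundary formula over any coefficient ring, applied both to Laurent
  polynomials and to the scalar coefficients of a single exponent.\<close>

definition alt_sum :: "('v list \<Rightarrow> 'a::ring_1) \<Rightarrow> 'v list \<Rightarrow> 'a" where
  "alt_sum f \<sigma> = (\<Sum>i<length \<sigma>. (- 1) ^ i * f (take i \<sigma> @ drop (Suc i) \<sigma>))"

lemma alt_sum_Nil [simp]: "alt_sum f [] = 0"
  by (simp add: alt_sum_def)

lemma alt_sum_Cons: "alt_sum f (x # \<sigma>) = f \<sigma> - alt_sum (\<lambda>\<tau>. f (x # \<tau>)) \<sigma>"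
  by (simp add: alt_sum_def sum.lessThan_Suc_shift sum_negf del: sum.lessThan_Suc)

lemma alt_sum_diff: "alt_sum (\<lambda>\<tau>. f \<tau> - g \<tau>) \<sigma> = alt_sum f \<sigma> - alt_sum g \<sigma>"
  by (simp add: alt_sum_def sum_subtractf algebra_simps)

text \<open>Splitting off the head twice with \<open>alt_sum_Cons\<close> cancels the terms without
  \<open>x\<close> and leaves the double sum of \<open>\<lambda>\<tau>. f (x # \<tau>)\<close> over
  the tail, which vanishes by induction.\<close>

lemma alt_sum_alt_sum: "alt_sum (alt_sum f) \<sigma> = 0"
proof (induction \<sigma> arbitrary: f)
  case (Cons x \<sigma>)
  then show ?case
    by (simp add: alt_sum_Cons alt_sum_diff)
qed simp

lemma set_face_subset: "set (take i \<sigma> @ drop j \<sigma>) \<subseteq> set \<sigma>"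
  using set_take_subset[of i \<sigma>] set_drop_subset[of j \<sigma>] by auto

lemma alt_sum_cong_subset:
  assumes "\<And>\<tau>. set \<tau> \<subseteq> set \<sigma> \<Longrightarrow> f \<tau> = g \<tau>"
  shows "alt_sum f \<sigma> = alt_sum g \<sigma>"
  unfolding alt_sum_def using assms[OF set_face_subset] by simp

lemma alt_sum_nonzeroE:
  assumes "alt_sum f \<sigma> \<noteq> 0"
  obtains \<tau> where "f \<tau> \<noteq> 0" "length \<sigma> = Suc (length \<tau>)" "set \<tau> \<subseteq> set \<sigma>"
proof -
  obtain i where i: "i < length \<sigma>" "f (take i \<sigma> @ drop (Suc i) \<sigma>) \<noteq> 0"
    using assms unfolding alt_sum_def by (metis (no_types, lifting) lessThan_iff mult_zero_right sum.neutral)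
  show ?thesis
    using that[OF i(2)] i(1) set_face_subset[of i \<sigma> "Suc i"] by simp
qed

text \<open>The index \<open>n\<close> is the length of the tuples, that is the Cech degree plus
  one. The clause \<open>\<sigma> \<noteq> []\<close> makes the group at \<open>n = 0\<close> zero,
  so the complex is not augmented. Vanishing off the support lets cochains be compared as
  functions.\<close>

definition tuple_cochains :: "'v set \<Rightarrow> 'v set set \<Rightarrow> nat \<Rightarrow> ('v list \<Rightarrow> 'a::ring_1) set" where
  "tuple_cochains V \<N> n =
    {f. \<forall>\<sigma>. f \<sigma> \<noteq> 0 \<longrightarrow> \<sigma> \<noteq> [] \<and> length \<sigma> = n \<and> set \<sigma> \<subseteq> V \<and> (\<forall>A\<in>\<N>. set \<sigma> \<inter> A \<noteq> {})}"

text \<open>Depends on neither \<open>n\<close> nor \<open>\<N>\<close>, so one map serves all the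
  complexes that are compared.\<close>

definition tuple_diff :: "'v set \<Rightarrow> ('v list \<Rightarrow> 'a::ring_1) \<Rightarrow> 'v list \<Rightarrow> 'a" where
  "tuple_diff V f \<sigma> = (if set \<sigma> \<subseteq> V then alt_sum f \<sigma> else 0)"

text \<open>At \<open>n = 0\<close> the truncated \<open>n - 1\<close> does no harm, because only
  the zero cochain lives there.\<close>

definition exact_at :: "'a::ring_1 itself \<Rightarrow> 'v set \<Rightarrow> 'v set set \<Rightarrow> nat \<Rightarrow> bool" where
  "exact_at _ V \<N> n \<longleftrightarrow>
    (\<forall>f\<in>tuple_cochains V \<N> n. tuple_diff V f = (\<lambda>_. 0::'a) \<longrightarrow>
      (\<exists>g\<in>tuple_cochains V \<N> (n - 1). tuple_diff V g = f))"

lemma tuple_cochains_0: "tuple_cochains V \<N> 0 = {\<lambda>_. 0}"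
  by (auto simp: tuple_cochains_def)

lemma tuple_diff_0 [simp]: "tuple_diff V (\<lambda>_. 0) = (\<lambda>_. 0)"
  by (auto simp: tuple_diff_def alt_sum_def)

lemma exact_at_0: "exact_at TYPE('a::ring_1) V \<N> 0"
  by (auto simp: exact_at_def tuple_cochains_0)

lemma tuple_diff_diff: "tuple_diff V (\<lambda>\<tau>. f \<tau> - g \<tau>) = (\<lambda>\<sigma>. tuple_diff V f \<sigma> - tuple_diff V g \<sigma>)"
  by (auto simp: tuple_diff_def alt_sum_diff)

lemma tuple_diff_tuple_diff: "tuple_diff V (tuple_diff V f) = (\<lambda>_. 0)"
proof
  fix \<sigma>
  have "alt_sum (tuple_diff V f) \<sigma> = alt_sum (alt_sum f) \<sigma>" if "set \<sigma> \<subseteq> V"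
    by (rule alt_sum_cong_subset) (use that in \<open>auto simp: tuple_diff_def\<close>)
  then show "tuple_diff V (tuple_diff V f) \<sigma> = 0"
    by (simp add: tuple_diff_def[of V "tuple_diff V f"] alt_sum_alt_sum)
qed

lemma tuple_diff_mem:
  assumes "f \<in> tuple_cochains V \<N> (n - 1)"
  shows "tuple_diff V f \<in> tuple_cochains V \<N> n"
proof (cases n)
  case 0
  then show ?thesis
    using assms by (simp add: tuple_cochains_0)
next
  case (Suc m)
  show ?thesis
    unfolding tuple_cochains_def
  proof (intro CollectI allI impI)
    fix \<sigma> assume nz: "tuple_diff V f \<sigma> \<noteq> 0"
    then have V: "set \<sigma> \<subseteq> V" and "alt_sum f \<sigma> \<noteq> 0"
      by (auto simp: tuple_diff_def split: if_splits)
    then obtain \<tau> where "f \<tau> \<noteq> 0" "length \<sigma> = Suc (length \<tau>)" "set \<tau> \<subseteq> set \<sigma>"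
      using alt_sum_nonzeroE by blast
    with assms Suc V show "\<sigma> \<noteq> [] \<and> length \<sigma> = n \<and> set \<sigma> \<subseteq> V \<and> (\<forall>A\<in>\<N>. set \<sigma> \<inter> A \<noteq> {})"
      unfolding tuple_cochains_def by fastforce
  qed
qed

section \<open>Subcomplexes and criteria for exactness\<close>

lemma tuple_cochains_insert_subset: "tuple_cochains V (insert A \<N>) n \<subseteq> tuple_cochains V \<N> n"
  by (auto simp: tuple_cochains_def)

lemma tuple_cochains_mono: "V \<subseteq> W \<Longrightarrow> tuple_cochains V \<N> n \<subseteq> tuple_cochains W \<N> n"
  unfolding tuple_cochains_def by blast

lemma tuple_cochains_add:
  assumes "f \<in> tuple_cochains V \<N> n" "g \<in> tuple_cochains V \<N> n"
  shows "(\<lambda>\<sigma>. f \<sigma> + g \<sigma>) \<in> tuple_cochains V \<N> n"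
  unfolding tuple_cochains_def
proof (intro CollectI allI impI)
  fix \<sigma> assume "f \<sigma> + g \<sigma> \<noteq> 0"
  then have "f \<sigma> \<noteq> 0 \<or> g \<sigma> \<noteq> 0" by auto
  then show "\<sigma> \<noteq> [] \<and> length \<sigma> = n \<and> set \<sigma> \<subseteq> V \<and> (\<forall>A\<in>\<N>. set \<sigma> \<inter> A \<noteq> {})"
    using assms unfolding tuple_cochains_def by blast
qed

lemma tuple_cochains_uminus:
  "f \<in> tuple_cochains V \<N> n \<Longrightarrow> (\<lambda>\<sigma>. - f \<sigma>) \<in> tuple_cochains V \<N> n"
  by (simp add: tuple_cochains_def)

lemma tuple_cochains_diff:
  "f \<in> tuple_cochains V \<N> n \<Longrightarrow> g \<in> tuple_cochains V \<N> n \<Longrightarrow> (\<lambda>\<sigma>. f \<sigma> - g \<sigma>) \<in> tuple_cochains V \<N> n"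
  using tuple_cochains_add[of f V \<N> n "\<lambda>\<sigma>. - g \<sigma>"] tuple_cochains_uminus[of g V \<N> n] by simp

text \<open>The next two lemmas unwind the long exact sequence of
  \<open>0 \<rightarrow> C(V, insert A \<N>) \<rightarrow> C(V, \<N>) \<rightarrow> C(V - A, \<N>) \<rightarrow> 0\<close>.\<close>

lemma exact_at_insert:
  fixes V :: "'v set"
  assumes "exact_at TYPE('a::ring_1) (V - A) \<N> n" and "exact_at TYPE('a) V \<N> (Suc n)"
  shows "exact_at TYPE('a) V (insert A \<N>) (Suc n)"
  unfolding exact_at_def
proof (intro ballI impI)
  fix f :: "'v list \<Rightarrow> 'a"
  assume f: "f \<in> tuple_cochains V (insert A \<N>) (Suc n)" and df: "tuple_diff V f = (\<lambda>_. 0)"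
  then obtain g where g: "g \<in> tuple_cochains V \<N> n" "tuple_diff V g = f"
    using assms(2) tuple_cochains_insert_subset[of V A \<N> "Suc n"]
    unfolding exact_at_def by (metis diff_Suc_1 subsetD)
  \<comment> \<open>The image of \<open>g\<close> in the quotient complex. It is a cocycle there,
    because \<open>f\<close>, the coboundary of \<open>g\<close>, vanishes on tuples that avoid
    \<open>A\<close>.\<close>
  define g1 where "g1 = (\<lambda>\<sigma>. if set \<sigma> \<subseteq> V - A then g \<sigma> else 0)"
  have g1: "g1 \<in> tuple_cochains (V - A) \<N> n"
    using g(1) by (auto simp: tuple_cochains_def g1_def)
  have "tuple_diff (V - A) g1 \<sigma> = 0" for \<sigma>
  proof (cases "set \<sigma> \<subseteq> V - A")
    case True
    have "alt_sum g1 \<sigma> = alt_sum g \<sigma>"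
      by (rule alt_sum_cong_subset) (use True in \<open>auto simp: g1_def\<close>)
    also have "\<dots> = f \<sigma>"
      using True by (auto simp: tuple_diff_def simp flip: g(2))
    also have "\<dots> = 0"
      using f True by (auto simp: tuple_cochains_def)
    finally show ?thesis
      by (simp add: tuple_diff_def)
  qed (simp add: tuple_diff_def)
  then obtain h where h: "h \<in> tuple_cochains (V - A) \<N> (n - 1)" "tuple_diff (V - A) h = g1"
    using assms(1) g1 unfolding exact_at_def by blast
  \<comment> \<open>Extension by zero lifts \<open>h\<close> to \<open>V\<close>. Subtracting its
    coboundary keeps the coboundary of \<open>g\<close> and removes the values of \<open>g\<close>
    on tuples avoiding \<open>A\<close>.\<close>
  have "h \<in> tuple_cochains V \<N> (n - 1)"
    using h(1) tuple_cochains_mono[of "V - A" V] by auto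
  then have "(\<lambda>\<sigma>. g \<sigma> - tuple_diff V h \<sigma>) \<in> tuple_cochains V \<N> n"
    by (intro tuple_cochains_diff g tuple_diff_mem)
  moreover have "g \<sigma> - tuple_diff V h \<sigma> = 0" if "set \<sigma> \<inter> A = {}" for \<sigma>
  proof (cases "set \<sigma> \<subseteq> V")
    case True
    then have "tuple_diff V h \<sigma> = tuple_diff (V - A) h \<sigma>" "set \<sigma> \<subseteq> V - A"
      using that by (auto simp: tuple_diff_def)
    then show ?thesis
      by (simp add: h g1_def)
  next
    case False
    then show ?thesis
      using g(1) by (auto simp: tuple_diff_def tuple_cochains_def)
  qed
  ultimately have "(\<lambda>\<sigma>. g \<sigma> - tuple_diff V h \<sigma>) \<in> tuple_cochains V (insert A \<N>) n"
    unfolding tuple_cochains_def by blast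
  moreover have "tuple_diff V (\<lambda>\<sigma>. g \<sigma> - tuple_diff V h \<sigma>) = f"
    by (simp add: tuple_diff_diff tuple_diff_tuple_diff g)
  ultimately show "\<exists>g\<in>tuple_cochains V (insert A \<N>) (Suc n - 1). tuple_diff V g = f"
    by auto
qed

lemma exact_at_Diff:
  fixes V :: "'v set"
  assumes "exact_at TYPE('a::ring_1) V (insert A \<N>) (Suc n)" and "exact_at TYPE('a) V \<N> n"
  shows "exact_at TYPE('a) (V - A) \<N> n"
  unfolding exact_at_def
proof (intro ballI impI)
  fix g :: "'v list \<Rightarrow> 'a"
  assume g: "g \<in> tuple_cochains (V - A) \<N> n" and dg: "tuple_diff (V - A) g = (\<lambda>_. 0)"
  have gV: "g \<in> tuple_cochains V \<N> n"
    using g tuple_cochains_mono[of "V - A" V] by auto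
  \<comment> \<open>The connecting map: the coboundary of the extension by zero vanishes on tuples
    avoiding \<open>A\<close>, hence lies in the subcomplex.\<close>
  have "tuple_diff V g \<in> tuple_cochains V \<N> (Suc n)"
    using gV by (intro tuple_diff_mem) simp
  moreover have "tuple_diff V g \<sigma> = 0" if "set \<sigma> \<inter> A = {}" for \<sigma>
  proof (cases "set \<sigma> \<subseteq> V")
    case True
    then have "tuple_diff V g \<sigma> = tuple_diff (V - A) g \<sigma>"
      using that by (auto simp: tuple_diff_def)
    then show ?thesis by (simp add: dg)
  qed (simp add: tuple_diff_def)
  ultimately have "tuple_diff V g \<in> tuple_cochains V (insert A \<N>) (Suc n)"
    unfolding tuple_cochains_def by blast
  then obtain h where h: "h \<in> tuple_cochains V (insert A \<N>) n" "tuple_diff V h = tuple_diff V g"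
    using assms(1) tuple_diff_tuple_diff unfolding exact_at_def by (metis diff_Suc_1)
  have "(\<lambda>\<sigma>. g \<sigma> - h \<sigma>) \<in> tuple_cochains V \<N> n"
    using h(1) tuple_cochains_insert_subset by (intro tuple_cochains_diff gV) blast
  moreover have "tuple_diff V (\<lambda>\<sigma>. g \<sigma> - h \<sigma>) = (\<lambda>_. 0)"
    by (simp add: tuple_diff_diff h)
  ultimately obtain u where u: "u \<in> tuple_cochains V \<N> (n - 1)"
      "tuple_diff V u = (\<lambda>\<sigma>. g \<sigma> - h \<sigma>)"
    using assms(2) unfolding exact_at_def by blast
  \<comment> \<open>Restriction to \<open>V - A\<close> kills the correction \<open>h\<close>, which
    is supported on tuples meeting \<open>A\<close>.\<close>
  define u1 where "u1 = (\<lambda>\<sigma>. if set \<sigma> \<subseteq> V - A then u \<sigma> else 0)"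
  have "u1 \<in> tuple_cochains (V - A) \<N> (n - 1)"
    using u(1) by (auto simp: tuple_cochains_def u1_def)
  moreover have "tuple_diff (V - A) u1 \<sigma> = g \<sigma>" for \<sigma>
  proof (cases "set \<sigma> \<subseteq> V - A")
    case True
    have "alt_sum u1 \<sigma> = alt_sum u \<sigma>"
      by (rule alt_sum_cong_subset) (use True in \<open>auto simp: u1_def\<close>)
    also have "\<dots> = g \<sigma> - h \<sigma>"
      using fun_cong[OF u(2), of \<sigma>] subset_trans[OF True Diff_subset] by (simp add: tuple_diff_def)
    also have "h \<sigma> = 0"
      using h(1) True by (auto simp: tuple_cochains_def)
    finally show ?thesis
      using True by (simp add: tuple_diff_def)
  next
    case False
    then show ?thesis
      using g by (auto simp: tuple_diff_def tuple_cochains_def)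
  qed
  ultimately show "\<exists>u\<in>tuple_cochains (V - A) \<N> (n - 1). tuple_diff (V - A) u = g"
    by blast
qed

text \<open>A nonempty tuple of points of \<open>V\<close> meets \<open>A\<close> automatically, so
  the two complexes coincide.\<close>

lemma exact_at_superset:
  fixes V :: "'v set"
  assumes "V \<subseteq> A"
  shows "exact_at TYPE('a::ring_1) V (insert A \<N>) n \<longleftrightarrow> exact_at TYPE('a) V \<N> n"
proof -
  have ne: "set \<sigma> \<inter> A \<noteq> {}" if "\<sigma> \<noteq> []" "set \<sigma> \<subseteq> V" for \<sigma>
  proof -
    have "hd \<sigma> \<in> set \<sigma>" using that by simp
    then show ?thesis using that assms by blast
  qed
  have "tuple_cochains V (insert A \<N>) n = (tuple_cochains V \<N> n :: ('v list \<Rightarrow> 'a::ring_1) set)" for n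
    unfolding tuple_cochains_def using ne by (intro Collect_cong) auto
  then show ?thesis
    by (simp add: exact_at_def)
qed

text \<open>Prepending \<open>t\<close> is a contracting homotopy; it only fails on constant \<open>0\<close>-cochains.\<close>

lemma tuple_diff_cone:
  assumes "t \<in> V" "tuple_diff V f = (\<lambda>_. 0)" "set \<sigma> \<subseteq> V"
  shows "alt_sum (\<lambda>\<tau>. f (t # \<tau>)) \<sigma> = f \<sigma>"
  using fun_cong[OF assms(2), of "t # \<sigma>"] assms(1,3) by (simp add: tuple_diff_def alt_sum_Cons)

lemma exact_at_cone:
  fixes V :: "'v set"
  assumes "t \<in> V" "\<And>A. A \<in> \<N> \<Longrightarrow> t \<notin> A" "\<N> \<noteq> {} \<or> n \<noteq> 1"
  shows "exact_at TYPE('a::ring_1) V \<N> n"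
  unfolding exact_at_def
proof (intro ballI impI)
  fix f :: "'v list \<Rightarrow> 'a"
  assume f: "f \<in> tuple_cochains V \<N> n" and df: "tuple_diff V f = (\<lambda>_. 0)"
  define g where "g \<sigma> = f (t # \<sigma>)" for \<sigma>
  have "g \<in> tuple_cochains V \<N> (n - 1)"
    unfolding tuple_cochains_def
  proof (intro CollectI allI impI)
    fix \<sigma> assume "g \<sigma> \<noteq> 0"
    then have "length (t # \<sigma>) = n \<and> set (t # \<sigma>) \<subseteq> V \<and> (\<forall>A\<in>\<N>. set (t # \<sigma>) \<inter> A \<noteq> {})"
      using f unfolding tuple_cochains_def g_def by blast
    then have "Suc (length \<sigma>) = n" "set \<sigma> \<subseteq> V" and cov: "\<forall>A\<in>\<N>. set (t # \<sigma>) \<inter> A \<noteq> {}"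
      by auto
    moreover have cov': "\<forall>A\<in>\<N>. set \<sigma> \<inter> A \<noteq> {}"
      using cov assms(2) by auto
    \<comment> \<open>If \<open>\<sigma>\<close> were empty, then \<open>n = 1\<close>, so
      \<open>\<N>\<close> would have a member by hypothesis, and the empty tuple cannot meet
      it.\<close>
    moreover have "\<sigma> \<noteq> []"
      using assms(3) cov' \<open>Suc (length \<sigma>) = n\<close> by auto
    ultimately show "\<sigma> \<noteq> [] \<and> length \<sigma> = n - 1 \<and> set \<sigma> \<subseteq> V \<and> (\<forall>A\<in>\<N>. set \<sigma> \<inter> A \<noteq> {})"
      by auto
  qed
  moreover have "tuple_diff V g = f"
  proof
    fix \<sigma>
    have "f \<sigma> = 0" if "\<not> set \<sigma> \<subseteq> V"
      using f that by (auto simp: tuple_cochains_def)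
    then show "tuple_diff V g \<sigma> = f \<sigma>"
      using tuple_diff_cone[OF assms(1) df, of \<sigma>] by (simp add: tuple_diff_def g_def[abs_def])
  qed
  ultimately show "\<exists>g\<in>tuple_cochains V \<N> (n - 1). tuple_diff V g = f"
    by blast
qed

text \<open>The cochain constantly one on single points is a cocycle, and only the zero cochain lies
  below it: this is the class of constants in degree zero.\<close>

lemma not_exact_at_1:
  fixes V :: "'v set"
  assumes "t \<in> V"
  shows "\<not> exact_at TYPE('a::ring_1) V {} 1"
proof
  assume ex: "exact_at TYPE('a) V {} 1"
  define f :: "'v list \<Rightarrow> 'a" where "f \<sigma> = (if length \<sigma> = 1 \<and> set \<sigma> \<subseteq> V then 1 else 0)" for \<sigma>
  have "f \<in> tuple_cochains V {} 1"
    by (auto simp: tuple_cochains_def f_def)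
  moreover have "tuple_diff V f \<sigma> = 0" for \<sigma>
  proof (cases "set \<sigma> \<subseteq> V \<and> length \<sigma> = 2")
    case True
    then obtain x y where "\<sigma> = [x, y]"
      by (auto simp: length_Suc_conv numeral_2_eq_2)
    then show ?thesis
      using True by (simp add: tuple_diff_def alt_sum_Cons f_def)
  next
    case False
    then show ?thesis
      by (auto simp: tuple_diff_def alt_sum_def f_def intro!: sum.neutral)
  qed
  ultimately have "f [t] = 0"
    using ex by (auto simp: exact_at_def tuple_cochains_0)
  then show False
    using assms by (simp add: f_def)
qed

section \<open>Boxes with conditions on coordinates\<close>

text \<open>Among charts, these are the ones on which \<open>x_(k,i)\<close> is invertible, for
  \<open>p = (k, i)\<close>; a monomial with a negative exponent there needs such a chart in the
  tuple.\<close>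

definition coord_eq :: "'i \<times> 'j \<Rightarrow> ('i \<Rightarrow> 'j) set" where
  "coord_eq p = {s. s (fst p) = snd p}"

text \<open>Discarding the points with a given coordinate turns a box into a box, which keeps the
  induction of \<open>exact_at_box\<close> within its class.\<close>

lemma PiE_remove:
  assumes "k \<in> K"
  shows "PiE K (B(k := B k - {i})) = PiE K B - coord_eq (k, i)"
  using assms by (fastforce simp: PiE_iff coord_eq_def split: if_splits)

text \<open>Induction on \<open>card N\<close>. The inclusion of \<open>Sigma\<close> in
  \<open>N\<close> says that each factor touched by \<open>N\<close> is full. When two conditions
  sit in one factor, the long exact sequence trades one of them for a smaller box with the degree
  shifted by one, so a full factor contributes its size minus one. A touched factor that is not full
  leads to a cone point in the end. The outer \<open>Suc\<close> converts degree to tuple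
  length.\<close>

lemma exact_at_box:
  assumes "finite K" "\<And>k. k \<in> K \<Longrightarrow> finite (B k) \<and> B k \<noteq> {}" "N \<subseteq> Sigma K B"
  shows "exact_at TYPE('a::ring_1) (PiE K B) (coord_eq ` N) n \<longleftrightarrow>
    \<not> (Sigma (fst ` N) B \<subseteq> N \<and> n = Suc (\<Sum>k\<in>fst ` N. card (B k) - 1))"
  using assms(2,3)
proof (induction "card N" arbitrary: N B n rule: less_induct)
  case less
  have finN: "finite N"
    using less.prems assms(1) by (meson finite_SigmaI finite_subset)
  then have finf: "finite (fst ` N)" by simp
  have "PiE K B \<noteq> {}"
    using less.prems by (simp add: PiE_eq_empty_iff)
  then obtain t0 where t0: "t0 \<in> PiE K B" by blast
  consider (empty) "N = {}" | (single) k i where "(k, i) \<in> N" "B k = {i}"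
    | (two) k i j where "(k, i) \<in> N" "(k, j) \<in> N" "i \<noteq> j"
    | (cone) "N \<noteq> {}" "\<And>k i. (k, i) \<in> N \<Longrightarrow> B k \<noteq> {i}"
        "\<And>k i j. (k, i) \<in> N \<Longrightarrow> (k, j) \<in> N \<Longrightarrow> i = j"
    by blast
  then show ?case
  proof cases
    case empty
    then show ?thesis
      using exact_at_cone[OF t0, of "{}" n] not_exact_at_1[OF t0] by (cases "n = 1") auto
  next
    case single
    define N0 where "N0 = N - {(k, i)}"
    have N: "N = insert (k, i) N0" and pN0: "(k, i) \<notin> N0"
      using single by (auto simp: N0_def)
    have sub: "N0 \<subseteq> Sigma K B"
      using less.prems N by auto
    have k0: "k \<notin> fst ` N0" and kK: "k \<in> K"
      using less.prems single pN0 sub by auto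
    have "PiE K B \<subseteq> coord_eq (k, i)"
      using kK single(2) by (auto simp: coord_eq_def PiE_iff)
    then have "exact_at TYPE('a) (PiE K B) (coord_eq ` N) n \<longleftrightarrow>
        exact_at TYPE('a) (PiE K B) (coord_eq ` N0) n"
      unfolding N image_insert by (rule exact_at_superset)
    also have "\<dots> \<longleftrightarrow> \<not> (Sigma (fst ` N0) B \<subseteq> N0 \<and> n = Suc (\<Sum>k\<in>fst ` N0. card (B k) - 1))"
      using less.prems sub finN pN0 by (intro less.hyps) (auto simp: N)
    also have "Sigma (fst ` N0) B \<subseteq> N0 \<longleftrightarrow> Sigma (fst ` N) B \<subseteq> N"
    proof -
      have "Sigma (fst ` N) B = insert (k, i) (Sigma (fst ` N0) B)"
        using single(2) unfolding N by auto
      moreover have "(k, i) \<notin> Sigma (fst ` N0) B"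
        using k0 by auto
      then have "Sigma (fst ` N0) B \<subseteq> N0 \<longleftrightarrow> insert (k, i) (Sigma (fst ` N0) B) \<subseteq> insert (k, i) N0"
        using pN0 by blast
      ultimately show ?thesis
        by (simp only: N)
    qed
    also have "(\<Sum>k\<in>fst ` N0. card (B k) - 1) = (\<Sum>k\<in>fst ` N. card (B k) - 1)"
      using single(2) k0 finN unfolding N by simp
    finally show ?thesis .
  next
    case two
    define N0 where "N0 = N - {(k, i)}"
    define B' where "B' = B(k := B k - {i})"
    have N: "N = insert (k, i) N0" and pN0: "(k, i) \<notin> N0" "(k, j) \<in> N0"
      using two by (auto simp: N0_def)
    have kK: "k \<in> K" "i \<in> B k" "j \<in> B k"
      using less.prems two by auto
    have card0: "card N0 < card N"
      using finN pN0 by (simp add: N)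
    have sub: "N0 \<subseteq> Sigma K B" "N0 \<subseteq> Sigma K B'"
      using less.prems N pN0 by (auto simp: B'_def split: if_splits)
    have B': "\<And>k. k \<in> K \<Longrightarrow> finite (B' k) \<and> B' k \<noteq> {}"
      using less.prems kK two by (auto simp: B'_def)
    \<comment> \<open>Factor \<open>k\<close> still carries the condition \<open>(k, j)\<close> but
      lacks \<open>(k, i)\<close>, so it is not full and the middle complex is exact at every
      length.\<close>
    have ex0: "exact_at TYPE('a) (PiE K B) (coord_eq ` N0) n'" for n'
    proof -
      have "\<not> Sigma (fst ` N0) B \<subseteq> N0"
        using pN0 kK by force
      then show ?thesis
        using less.hyps[OF card0 less.prems(1) sub(1)] by blast
    qed
    have fst0: "fst ` N0 = fst ` N"
      using pN0 by (force simp: N)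
    have card': "card (B k) - 1 = Suc (card (B' k) - 1)"
    proof -
      have "card (B' k) = card (B k) - 1"
        using kK less.prems by (simp add: B'_def)
      moreover have "card {i, j} \<le> card (B k)"
        using kK less.prems by (intro card_mono) auto
      ultimately show ?thesis using two by simp
    qed
    have sums: "(\<Sum>k\<in>fst ` N. card (B k) - 1) = Suc (\<Sum>k\<in>fst ` N. card (B' k) - 1)"
    proof -
      have kf: "k \<in> fst ` N" using two by force
      have "(\<Sum>k\<in>fst ` N - {k}. card (B k) - 1) = (\<Sum>k\<in>fst ` N - {k}. card (B' k) - 1)"
        by (intro sum.cong) (auto simp: B'_def)
      then show ?thesis
        unfolding sum.remove[OF finf kf] card' by simp
    qed
    show ?thesis
    proof (cases n)
      case 0
      then show ?thesis by (simp add: exact_at_0)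
    next
      case (Suc n')
      \<comment> \<open>The middle complex being exact, the connecting map compares length
        \<open>n\<close> in the subcomplex with length \<open>n'\<close> in the quotient, which is
        again the complex of a box.\<close>
      have "exact_at TYPE('a) (PiE K B) (coord_eq ` N) n \<longleftrightarrow>
          exact_at TYPE('a) (PiE K B') (coord_eq ` N0) n'"
        unfolding N image_insert Suc B'_def PiE_remove[OF kK(1)]
        using exact_at_insert exact_at_Diff ex0 by blast
      also have "\<dots> \<longleftrightarrow> \<not> (Sigma (fst ` N0) B' \<subseteq> N0 \<and> n' = Suc (\<Sum>k\<in>fst ` N0. card (B' k) - 1))"
        using less.hyps[OF card0 B' sub(2)] .
      also have "Sigma (fst ` N0) B' \<subseteq> N0 \<longleftrightarrow> Sigma (fst ` N) B \<subseteq> N"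
      proof -
        have S: "Sigma (fst ` N) B = insert (k, i) (Sigma (fst ` N) B')"
          using two kK by (force simp: B'_def split: if_splits)
        have "(k, i) \<notin> Sigma (fst ` N) B'"
          by (auto simp: B'_def)
        then have "Sigma (fst ` N) B' \<subseteq> N0 \<longleftrightarrow> insert (k, i) (Sigma (fst ` N) B') \<subseteq> insert (k, i) N0"
          using pN0 by blast
        then show ?thesis
          by (simp only: S fst0 flip: N)
      qed
      also have "n' = Suc (\<Sum>k\<in>fst ` N0. card (B' k) - 1) \<longleftrightarrow>
          n = Suc (\<Sum>k\<in>fst ` N. card (B k) - 1)"
        unfolding sums fst0 Suc by simp
      finally show ?thesis .
    qed
  next
    case cone
    \<comment> \<open>Each touched factor has just one condition and at least two values; a value
      outside \<open>N\<close> in every factor gives a cone point.\<close>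
    have "\<exists>i. i \<in> B k \<and> (k, i) \<notin> N" if "k \<in> K" for k
    proof (rule ccontr)
      assume "\<nexists>i. i \<in> B k \<and> (k, i) \<notin> N"
      moreover obtain i where "i \<in> B k" using less.prems \<open>k \<in> K\<close> by blast
      ultimately show False
        using cone(2,3) by blast
    qed
    then obtain t where t: "\<And>k. k \<in> K \<Longrightarrow> t k \<in> B k \<and> (k, t k) \<notin> N"
      by metis
    have "exact_at TYPE('a) (PiE K B) (coord_eq ` N) n"
    proof (rule exact_at_cone)
      show "restrict t K \<in> PiE K B"
        using t by auto
      show "restrict t K \<notin> A" if "A \<in> coord_eq ` N" for A
        using that t less.prems by (fastforce simp: coord_eq_def)
    qed (use cone in auto)
    moreover have "\<not> Sigma (fst ` N) B \<subseteq> N"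
    proof -
      obtain k i where "(k, i) \<in> N" using cone by auto
      moreover have "t k \<in> B k \<and> (k, t k) \<notin> N"
        using t less.prems calculation by auto
      ultimately show ?thesis by force
    qed
    ultimately show ?thesis by simp
  qed
qed

section \<open>Cohomology of line bundles on products of projective spaces\<close>

definition exponents :: "nat \<Rightarrow> (nat \<Rightarrow> nat) \<Rightarrow> (nat \<Rightarrow> int) \<Rightarrow> (nat \<times> nat \<Rightarrow>\<^sub>0 int) set" where
  "exponents r l a =
    {e. Poly_Mapping.keys e \<subseteq> (SIGMA k:{1..r}. {..l k}) \<and>
      (\<forall>k\<in>{1..r}. (\<Sum>i\<le>l k. Poly_Mapping.lookup e (k, i)) = a k)}"

definition neg_coords :: "nat \<Rightarrow> (nat \<Rightarrow> nat) \<Rightarrow> (nat \<times> nat \<Rightarrow>\<^sub>0 int) \<Rightarrow> (nat \<times> nat) set" where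
  "neg_coords r l e = {p \<in> SIGMA k:{1..r}. {..l k}. Poly_Mapping.lookup e p < 0}"

definition coeff_at :: "(nat \<times> nat \<Rightarrow>\<^sub>0 int) \<Rightarrow> ('v \<Rightarrow> 'k::field laurent) \<Rightarrow> 'v \<Rightarrow> 'k" where
  "coeff_at e f \<sigma> = Poly_Mapping.lookup (f \<sigma>) e"

lemma coeff_at_eqI: "(\<And>e. coeff_at e f = coeff_at e g) \<Longrightarrow> f = g"
  by (simp add: fun_eq_iff coeff_at_def poly_mapping_eq_iff)

lemma coeff_at_zero [simp]: "coeff_at e (\<lambda>_. 0) = (\<lambda>_. 0)"
  by (simp add: fun_eq_iff coeff_at_def)

text \<open>The bound on poles becomes a condition of meeting sets: a coordinate may have a negative
  exponent over \<open>S\<close> exactly when some chart in \<open>S\<close> inverts it.\<close>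

lemma mem_sections_iff:
  "f \<in> sections r l a S \<longleftrightarrow>
    (\<forall>e. Poly_Mapping.lookup f e \<noteq> 0 \<longrightarrow>
      e \<in> exponents r l a \<and> (\<forall>A\<in>coord_eq ` neg_coords r l e. S \<inter> A \<noteq> {}))"
proof -
  have "S \<inter> coord_eq (k, i) \<noteq> {} \<longleftrightarrow> i \<in> (\<lambda>s. s k) ` S" for k i
    by (auto simp: coord_eq_def)
  then have "(\<forall>A\<in>coord_eq ` neg_coords r l e. S \<inter> A \<noteq> {}) \<longleftrightarrow>
      (\<forall>k\<in>{1..r}. \<forall>i\<le>l k. Poly_Mapping.lookup e (k, i) < 0 \<longrightarrow> i \<in> (\<lambda>s. s k) ` S)" for e :: "nat \<times> nat \<Rightarrow>\<^sub>0 int"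
    by (simp add: neg_coords_def Ball_def image_iff) blast
  moreover have "(\<forall>k\<in>{1..r}. \<forall>i\<le>l k. Poly_Mapping.lookup e (k, i) < 0 \<longrightarrow> i \<in> (\<lambda>s. s k) ` S) \<longleftrightarrow>
      (\<forall>k\<in>{1..r}. \<forall>i\<le>l k. i \<notin> (\<lambda>s. s k) ` S \<longrightarrow> Poly_Mapping.lookup e (k, i) \<ge> 0)" for e :: "nat \<times> nat \<Rightarrow>\<^sub>0 int"
  proof -
    have nonneg: "0 \<le> x \<longleftrightarrow> \<not> x < 0" for x :: int by auto
    show ?thesis unfolding nonneg by blast
  qed
  ultimately show ?thesis
    unfolding sections_def by (simp add: exponents_def Ball_def[of "Poly_Mapping.keys f"] in_keys_iff)
qed

text \<open>The conditions concern one pair of tuple and exponent at a time, so they can be grouped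
  by exponent. For negative \<open>q\<close> the truncation by \<open>nat\<close> gives length zero,
  where only the zero cochain exists, in agreement with the integer grading.\<close>

lemma mem_cochains_iff:
  "f \<in> cochains r l a q \<longleftrightarrow>
    (\<forall>e. coeff_at e f \<in> tuple_cochains (charts r l) (coord_eq ` neg_coords r l e) (nat (q + 1)) \<and>
      (e \<notin> exponents r l a \<longrightarrow> coeff_at e f = (\<lambda>_. 0)))"
proof -
  define cov where "cov e \<sigma> \<longleftrightarrow> (\<forall>A\<in>coord_eq ` neg_coords r l e. set \<sigma> \<inter> A \<noteq> {})" for e \<sigma>
  have simplices: "\<sigma> \<in> simplices r l q \<longleftrightarrow> \<sigma> \<noteq> [] \<and> length \<sigma> = nat (q + 1) \<and> set \<sigma> \<subseteq> charts r l" for \<sigma>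
    by (cases \<sigma>) (auto simp: simplices_def)
  have zero: "f \<sigma> = 0 \<longleftrightarrow> (\<forall>e. Poly_Mapping.lookup (f \<sigma>) e = 0)" for \<sigma>
    by (simp add: poly_mapping_eq_iff fun_eq_iff)
  have "f \<in> cochains r l a q \<longleftrightarrow>
      (\<forall>\<sigma> e. Poly_Mapping.lookup (f \<sigma>) e \<noteq> 0 \<longrightarrow>
        \<sigma> \<in> simplices r l q \<and> e \<in> exponents r l a \<and> cov e \<sigma>)"
    unfolding cochains_def mem_sections_iff mem_Collect_eq zero cov_def[symmetric] by blast
  also have "\<dots> \<longleftrightarrow> (\<forall>e. (\<forall>\<sigma>. Poly_Mapping.lookup (f \<sigma>) e \<noteq> 0 \<longrightarrow> \<sigma> \<in> simplices r l q \<and> cov e \<sigma>) \<and>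
      (e \<notin> exponents r l a \<longrightarrow> (\<forall>\<sigma>. Poly_Mapping.lookup (f \<sigma>) e = 0)))"
    by blast
  finally show ?thesis
    unfolding tuple_cochains_def coeff_at_def fun_eq_iff simplices cov_def by simp
qed

lemma cochains_tuple_cochains:
  assumes "f \<in> cochains r l a q"
  shows "f \<in> tuple_cochains (charts r l) {} (nat (q + 1))"
  unfolding tuple_cochains_def
proof (intro CollectI allI impI)
  fix \<sigma> assume "f \<sigma> \<noteq> 0"
  then have "\<sigma> \<in> simplices r l q"
    using assms unfolding cochains_def by blast
  then show "\<sigma> \<noteq> [] \<and> length \<sigma> = nat (q + 1) \<and> set \<sigma> \<subseteq> charts r l \<and> (\<forall>A\<in>{}. set \<sigma> \<inter> A \<noteq> {})"
    by (auto simp: simplices_def)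
qed

text \<open>The restriction to simplices of degree \<open>q + 1\<close> is automatic for a cochain,
  since the faces of a tuple have the right length only if the tuple has.\<close>

lemma coboundary_eq_tuple_diff:
  assumes "f \<in> cochains r l a q"
  shows "coboundary r l q f = tuple_diff (charts r l) f"
proof
  fix \<sigma>
  show "coboundary r l q f \<sigma> = tuple_diff (charts r l) f \<sigma>"
  proof (cases "\<sigma> \<in> simplices r l (q + 1)")
    case True
    then have "set \<sigma> \<subseteq> charts r l"
      by (simp add: simplices_def)
    with True show ?thesis
      unfolding coboundary_def tuple_diff_def alt_sum_def by simp
  next
    case False
    have "tuple_diff (charts r l) f \<sigma> = 0"
    proof (rule ccontr)
      assume nz: "tuple_diff (charts r l) f \<sigma> \<noteq> 0"
      have "tuple_diff (charts r l) f \<in> tuple_cochains (charts r l) {} (Suc (nat (q + 1)))"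
        using cochains_tuple_cochains[OF assms] by (intro tuple_diff_mem) simp
      with nz have \<sigma>: "\<sigma> \<noteq> []" "length \<sigma> = Suc (nat (q + 1))" "set \<sigma> \<subseteq> charts r l"
        unfolding tuple_cochains_def by blast+
      \<comment> \<open>For \<open>q < - 1\<close> the truncated length would admit tuples of length
        one, although there are no simplices of degree \<open>q + 1\<close>; but then
        \<open>f\<close> is zero.\<close>
      have "\<not> q < - 1"
      proof
        assume "q < - 1"
        then have "f = (\<lambda>_. 0)"
          using cochains_tuple_cochains[OF assms] by (simp add: tuple_cochains_0)
        then show False
          using nz by simp
      qed
      then show False
        using \<sigma> False by (simp add: simplices_def)
    qed
    with False show ?thesis
      by (simp add: coboundary_def)
  qed
qed

lemma lookup_minus_one_power_times:
  "Poly_Mapping.lookup ((- 1) ^ i * (x :: 'k::field laurent)) e = (- 1) ^ i * Poly_Mapping.lookup x e"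
  by (cases "even i") auto

lemma coeff_at_tuple_diff: "coeff_at e (tuple_diff V f) = tuple_diff V (coeff_at e f)"
  by (auto simp: fun_eq_iff coeff_at_def tuple_diff_def alt_sum_def lookup_sum lookup_minus_one_power_times)

lemma coeff_at_add: "coeff_at e (\<lambda>\<sigma>. f \<sigma> + g \<sigma>) = (\<lambda>\<sigma>. coeff_at e f \<sigma> + coeff_at e g \<sigma>)"
  by (simp add: fun_eq_iff coeff_at_def lookup_add)

lemma coeff_at_uminus: "coeff_at e (\<lambda>\<sigma>. - f \<sigma>) = (\<lambda>\<sigma>. - coeff_at e f \<sigma>)"
  by (simp add: fun_eq_iff coeff_at_def)

lemma cochains_add:
  "f \<in> cochains r l a q \<Longrightarrow> g \<in> cochains r l a q \<Longrightarrow> (\<lambda>\<sigma>. f \<sigma> + g \<sigma>) \<in> cochains r l a q"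
  unfolding mem_cochains_iff coeff_at_add by (simp add: tuple_cochains_add)

lemma cochains_uminus: "f \<in> cochains r l a q \<Longrightarrow> (\<lambda>\<sigma>. - f \<sigma>) \<in> cochains r l a q"
  unfolding mem_cochains_iff coeff_at_uminus by (simp add: tuple_cochains_uminus)

lemma cochains_zero: "(\<lambda>_. 0) \<in> cochains r l a q"
  by (simp add: mem_cochains_iff tuple_cochains_def)

lemma coboundary_zero: "coboundary r l q (\<lambda>_. 0) = (\<lambda>_. 0)"
  by (simp add: fun_eq_iff coboundary_def)

lemma coboundary_add:
  "coboundary r l q (\<lambda>\<sigma>. f \<sigma> + g \<sigma>) = (\<lambda>\<sigma>. coboundary r l q f \<sigma> + coboundary r l q g \<sigma>)"
  by (simp add: fun_eq_iff coboundary_def distrib_left sum.distrib)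

lemma coboundary_uminus: "coboundary r l q (\<lambda>\<sigma>. - f \<sigma>) = (\<lambda>\<sigma>. - coboundary r l q f \<sigma>)"
  by (simp add: fun_eq_iff coboundary_def sum_negf)

lemma nat_add_1_diff_1: "nat ((q::int) + 1) - 1 = nat q"
  by linarith

lemma coboundary_mem:
  assumes "f \<in> cochains r l a (q - 1)"
  shows "coboundary r l (q - 1) f \<in> cochains r l a q"
proof -
  have "coeff_at e f \<in> tuple_cochains (charts r l) (coord_eq ` neg_coords r l e) (nat (q + 1) - 1)" for e
    using assms by (simp add: mem_cochains_iff nat_add_1_diff_1[simplified])
  then have mem: "tuple_diff (charts r l) (coeff_at e f) \<in>
      tuple_cochains (charts r l) (coord_eq ` neg_coords r l e) (nat (q + 1))" for e
    by (rule tuple_diff_mem)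
  have zero: "tuple_diff (charts r l) (coeff_at e f) = (\<lambda>_. 0)" if "e \<notin> exponents r l a" for e
  proof -
    have "coeff_at e f = (\<lambda>_. 0)"
      using assms that unfolding mem_cochains_iff by blast
    then show ?thesis
      by (simp only: tuple_diff_0)
  qed
  show ?thesis
    unfolding coboundary_eq_tuple_diff[OF assms] mem_cochains_iff coeff_at_tuple_diff
    by (intro allI conjI impI mem zero)
qed

lemma coboundary_coboundary:
  assumes "f \<in> cochains r l a (q - 1)"
  shows "coboundary r l q (coboundary r l (q - 1) f) = (\<lambda>_. 0)"
proof -
  have "coboundary r l q (coboundary r l (q - 1) f) = tuple_diff (charts r l) (coboundary r l (q - 1) f)"
    by (rule coboundary_eq_tuple_diff[OF coboundary_mem[OF assms]])
  also have "\<dots> = (\<lambda>_. 0)"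
    unfolding coboundary_eq_tuple_diff[OF assms] by (rule tuple_diff_tuple_diff)
  finally show ?thesis .
qed

section \<open>Vanishing of the cohomology groups\<close>

lemma comm_group_cocycle_group: "comm_group (cocycle_group r l a q)"
proof (rule comm_groupI)
  fix f assume "f \<in> carrier (cocycle_group r l a q)"
  then show "\<exists>g\<in>carrier (cocycle_group r l a q).
      g \<otimes>\<^bsub>cocycle_group r l a q\<^esub> f = \<one>\<^bsub>cocycle_group r l a q\<^esub>"
    by (intro bexI[of _ "\<lambda>\<sigma>. - f \<sigma>"])
      (auto simp: cocycle_group_def cochains_uminus coboundary_uminus)
qed (auto simp: cocycle_group_def cochains_add coboundary_add cochains_zero coboundary_zero add_ac)

lemma subgroup_coboundaries:
  "subgroup (coboundary r l (q - 1) ` cochains r l a (q - 1))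
    (cocycle_group r l a q :: ((nat \<Rightarrow> nat) list \<Rightarrow> 'k::field laurent) monoid)"
  (is "subgroup ?B ?G")
proof -
  interpret comm_group ?G
    by (rule comm_group_cocycle_group)
  have inv: "inv\<^bsub>?G\<^esub> f = (\<lambda>\<sigma>. - f \<sigma>)" if "f \<in> carrier ?G" for f
    by (rule inv_equality)
      (use that in \<open>auto simp: cocycle_group_def cochains_uminus coboundary_uminus\<close>)
  have sub: "?B \<subseteq> carrier ?G"
    by (auto simp: cocycle_group_def coboundary_mem coboundary_coboundary)
  show ?thesis
  proof (rule subgroupI)
    show "?B \<noteq> {}"
      using cochains_zero by blast
    fix b assume "b \<in> ?B"
    then obtain f where f: "f \<in> cochains r l a (q - 1)" "b = coboundary r l (q - 1) f"
      by blast
    have "inv\<^bsub>?G\<^esub> b = (\<lambda>\<sigma>. - b \<sigma>)"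
      using inv sub \<open>b \<in> ?B\<close> by blast
    also have "\<dots> = coboundary r l (q - 1) (\<lambda>\<sigma>. - f \<sigma>)"
      by (simp add: f coboundary_uminus)
    finally show "inv\<^bsub>?G\<^esub> b \<in> ?B"
      using cochains_uminus[OF f(1)] by blast
    fix c assume "c \<in> ?B"
    then obtain g where g: "g \<in> cochains r l a (q - 1)" "c = coboundary r l (q - 1) g"
      by blast
    have "b \<otimes>\<^bsub>?G\<^esub> c = coboundary r l (q - 1) (\<lambda>\<sigma>. f \<sigma> + g \<sigma>)"
      by (simp add: f g cocycle_group_def coboundary_add)
    then show "b \<otimes>\<^bsub>?G\<^esub> c \<in> ?B"
      using cochains_add[OF f(1) g(1)] by blast
  qed (rule sub)
qed

lemma (in comm_group) trivial_group_FactGroup: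
  assumes "subgroup H G"
  shows "trivial_group (G Mod H) \<longleftrightarrow> carrier G \<subseteq> H"
proof -
  interpret H: normal H G
    using assms by (rule subgroup_imp_normal)
  have "r_coset G H x = H \<longleftrightarrow> x \<in> H" if "x \<in> carrier G" for x
  proof
    assume "r_coset G H x = H"
    moreover have "x \<in> r_coset G H x"
      by (rule rcos_self[OF that assms])
    ultimately show "x \<in> H" by simp
  next
    assume "x \<in> H"
    then show "r_coset G H x = H"
      by (intro coset_join2 that assms)
  qed
  moreover have "carrier (G Mod H) = {H} \<longleftrightarrow> (\<forall>x\<in>carrier G. r_coset G H x = H)"
  proof -
    have "f ` C = {y} \<longleftrightarrow> (\<forall>x\<in>C. f x = y)" if "c \<in> C" for f :: "'a \<Rightarrow> 'a set" and C c y
      using that by blast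
    from this[OF one_closed] show ?thesis
      unfolding carrier_FactGroup .
  qed
  moreover have "trivial_group (G Mod H) \<longleftrightarrow> carrier (G Mod H) = {H}"
    unfolding trivial_group_def one_FactGroup by (simp only: H.factorgroup_is_group simp_thms)
  ultimately show ?thesis
    by (simp add: subset_eq)
qed

lemma trivial_group_sum_group:
  assumes "\<And>i. i \<in> I \<Longrightarrow> group (G i)"
  shows "trivial_group (sum_group I G) \<longleftrightarrow> (\<forall>i\<in>I. trivial_group (G i))"
proof
  have one: "\<one>\<^bsub>G i\<^esub> \<in> carrier (G i)" if "i \<in> I" for i
    by (rule monoid.one_closed[OF group.is_monoid[OF assms[OF that]]])
  have carrier: "carrier (sum_group I G) =
      {x \<in> \<Pi>\<^sub>E i\<in>I. carrier (G i). finite {i \<in> I. x i \<noteq> \<one>\<^bsub>G i\<^esub>}}"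
    by (rule carrier_sum_group[OF assms])
  {
    assume triv: "trivial_group (sum_group I G)"
    show "\<forall>i\<in>I. trivial_group (G i)"
    proof
      fix i assume i: "i \<in> I"
      have "x = \<one>\<^bsub>G i\<^esub>" if x: "x \<in> carrier (G i)" for x
      proof -
        define y where "y = (\<lambda>j\<in>I. if j = i then x else \<one>\<^bsub>G j\<^esub>)"
        have "{j \<in> I. y j \<noteq> \<one>\<^bsub>G j\<^esub>} \<subseteq> {i}"
          by (auto simp: y_def)
        then have "finite {j \<in> I. y j \<noteq> \<one>\<^bsub>G j\<^esub>}"
          by (rule finite_subset) simp
        moreover have "y \<in> (\<Pi>\<^sub>E i\<in>I. carrier (G i))"
          unfolding y_def restrict_PiE_iff using x one by simp
        ultimately have "y \<in> carrier (sum_group I G)"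
          unfolding carrier by blast
        then have "y = (\<lambda>j\<in>I. \<one>\<^bsub>G j\<^esub>)"
          using triv unfolding trivial_group_def one_sum_group by blast
        from fun_cong[OF this, of i] show ?thesis
          using i by (simp add: y_def)
      qed
      then have "carrier (G i) = {\<one>\<^bsub>G i\<^esub>}"
        using one[OF i] by blast
      then show "trivial_group (G i)"
        using assms[OF i] by (simp add: trivial_group_def)
    qed
  }
  assume triv: "\<forall>i\<in>I. trivial_group (G i)"
  have "x = \<one>\<^bsub>sum_group I G\<^esub>" if "x \<in> carrier (sum_group I G)" for x
  proof
    fix i
    have x: "x \<in> (\<Pi>\<^sub>E i\<in>I. carrier (G i))"
      using that unfolding carrier by blast
    show "x i = \<one>\<^bsub>sum_group I G\<^esub> i"
    proof (cases "i \<in> I")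
      case True
      then have "x i \<in> {\<one>\<^bsub>G i\<^esub>}"
        using PiE_mem[OF x] triv by (simp add: trivial_group_def)
      then show ?thesis using True by simp
    next
      case False
      then show ?thesis using PiE_arb[OF x] by simp
    qed
  qed
  then have "carrier (sum_group I G) \<subseteq> {\<one>\<^bsub>sum_group I G\<^esub>}"
    by blast
  moreover have "group (sum_group I G)"
    using assms by simp
  ultimately show "trivial_group (sum_group I G)"
    by (simp add: group.trivial_group_subset)
qed

lemma group_cohomology: "group (cohomology r l q a)"
  unfolding cohomology_def
  by (intro normal.factorgroup_is_group comm_group.subgroup_imp_normal
      comm_group_cocycle_group subgroup_coboundaries)

lemma subset_image_iff_ex: "A \<subseteq> h ` C \<longleftrightarrow> (\<forall>x. x \<in> A \<longrightarrow> (\<exists>y\<in>C. h y = x))"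
  by blast

lemma trivial_cohomology_iff_exact:
  "trivial_group (cohomology r l q a :: ((nat \<Rightarrow> nat) list \<Rightarrow> 'k::field laurent) set monoid) \<longleftrightarrow>
    (\<forall>f::(nat \<Rightarrow> nat) list \<Rightarrow> 'k laurent. f \<in> cochains r l a q \<longrightarrow> tuple_diff (charts r l) f = (\<lambda>_. 0) \<longrightarrow>
      (\<exists>g\<in>cochains r l a (q - 1). tuple_diff (charts r l) g = f))"
proof -
  let ?G = "cocycle_group r l a q :: ((nat \<Rightarrow> nat) list \<Rightarrow> 'k laurent) monoid"
  have "carrier ?G = {f \<in> cochains r l a q. tuple_diff (charts r l) f = (\<lambda>_. 0)}"
    by (auto simp: cocycle_group_def coboundary_eq_tuple_diff)
  moreover have "coboundary r l (q - 1) ` cochains r l a (q - 1) =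
      (tuple_diff (charts r l) ` cochains r l a (q - 1) :: ((nat \<Rightarrow> nat) list \<Rightarrow> 'k laurent) set)"
    by (rule image_cong) (simp_all add: coboundary_eq_tuple_diff)
  ultimately have "trivial_group (cohomology r l q a :: ((nat \<Rightarrow> nat) list \<Rightarrow> 'k laurent) set monoid) \<longleftrightarrow>
      {f \<in> cochains r l a q. tuple_diff (charts r l) f = (\<lambda>_. 0)} \<subseteq>
      (tuple_diff (charts r l) ` cochains r l a (q - 1) :: ((nat \<Rightarrow> nat) list \<Rightarrow> 'k laurent) set)"
    unfolding cohomology_def
      comm_group.trivial_group_FactGroup[OF comm_group_cocycle_group subgroup_coboundaries] by simp
  also have "\<dots> \<longleftrightarrow> (\<forall>f::(nat \<Rightarrow> nat) list \<Rightarrow> 'k laurent. f \<in> cochains r l a q \<longrightarrow>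
      tuple_diff (charts r l) f = (\<lambda>_. 0) \<longrightarrow>
      (\<exists>g\<in>cochains r l a (q - 1). tuple_diff (charts r l) g = f))"
    unfolding subset_image_iff_ex mem_Collect_eq imp_conjL ..
  finally show ?thesis .
qed

lemma finite_charts: "finite (charts r l)"
  by (auto simp: charts_def intro!: finite_PiE)

text \<open>The differential acts on each exponent separately, so exactness can be tested one
  exponent at a time. Primitives can be summed up again because only finitely many exponents occur:
  there are finitely many tuples of a given length, and each value has finite support.\<close>

lemma trivial_cohomology_iff_exact_at:
  "trivial_group (cohomology r l q a :: ((nat \<Rightarrow> nat) list \<Rightarrow> 'k::field laurent) set monoid) \<longleftrightarrow>
    (\<forall>e\<in>exponents r l a. exact_at TYPE('k) (charts r l) (coord_eq ` neg_coords r l e) (nat (q + 1)))"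
  unfolding trivial_cohomology_iff_exact
proof (intro iffI ballI allI impI)
  fix e
  assume ex: "\<forall>f::(nat \<Rightarrow> nat) list \<Rightarrow> 'k laurent. f \<in> cochains r l a q \<longrightarrow>
      tuple_diff (charts r l) f = (\<lambda>_. 0) \<longrightarrow> (\<exists>g\<in>cochains r l a (q - 1). tuple_diff (charts r l) g = f)"
    and e: "e \<in> exponents r l a"
  show "exact_at TYPE('k) (charts r l) (coord_eq ` neg_coords r l e) (nat (q + 1))"
    unfolding exact_at_def
  proof (intro ballI impI)
    fix \<phi> :: "(nat \<Rightarrow> nat) list \<Rightarrow> 'k"
    assume \<phi>: "\<phi> \<in> tuple_cochains (charts r l) (coord_eq ` neg_coords r l e) (nat (q + 1))"
      and d\<phi>: "tuple_diff (charts r l) \<phi> = (\<lambda>_. 0)"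
    \<comment> \<open>Putting \<open>\<phi>\<close> on the single monomial \<open>e\<close> embeds
      the scalar complex into the Cech complex.\<close>
    define f where "f = (\<lambda>\<sigma>. Poly_Mapping.single e (\<phi> \<sigma>))"
    have coeff: "coeff_at e' f = (if e' = e then \<phi> else (\<lambda>_. 0))" for e'
      by (auto simp: coeff_at_def f_def lookup_single)
    have "f \<in> cochains r l a q"
      using e \<phi> by (simp add: mem_cochains_iff coeff) (simp add: tuple_cochains_def)
    moreover have "tuple_diff (charts r l) f = (\<lambda>_. 0)"
      by (rule coeff_at_eqI) (simp add: coeff_at_tuple_diff coeff d\<phi>)
    ultimately obtain g where g: "g \<in> cochains r l a (q - 1)" "tuple_diff (charts r l) g = f"
      using ex by blast
    show "\<exists>\<psi>\<in>tuple_cochains (charts r l) (coord_eq ` neg_coords r l e) (nat (q + 1) - 1).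
        tuple_diff (charts r l) \<psi> = \<phi>"
    proof
      show "coeff_at e g \<in> tuple_cochains (charts r l) (coord_eq ` neg_coords r l e) (nat (q + 1) - 1)"
        using g(1) by (simp add: mem_cochains_iff nat_add_1_diff_1[simplified])
      show "tuple_diff (charts r l) (coeff_at e g) = \<phi>"
        by (simp add: g coeff flip: coeff_at_tuple_diff)
    qed
  qed
next
  fix f :: "(nat \<Rightarrow> nat) list \<Rightarrow> 'k laurent"
  assume ex: "\<forall>e\<in>exponents r l a.
      exact_at TYPE('k) (charts r l) (coord_eq ` neg_coords r l e) (nat (q + 1))"
    and f: "f \<in> cochains r l a q" and df: "tuple_diff (charts r l) f = (\<lambda>_. 0)"
  define T where "T = {\<sigma>. set \<sigma> \<subseteq> charts r l \<and> length \<sigma> = nat (q + 1)}"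
  define E where "E = (\<Union>\<sigma>\<in>T. Poly_Mapping.keys (f \<sigma>))"
  have "finite T"
    unfolding T_def by (rule finite_lists_length_eq[OF finite_charts])
  then have "finite E"
    by (simp add: E_def)
  have outside: "coeff_at e f = (\<lambda>_. 0)" if "e \<notin> E" for e
  proof
    fix \<sigma>
    show "coeff_at e f \<sigma> = 0"
    proof (cases "\<sigma> \<in> T")
      case True
      then show ?thesis
        using that by (auto simp: E_def coeff_at_def in_keys_iff)
    next
      case False
      then show ?thesis
        using f by (auto simp: T_def mem_cochains_iff tuple_cochains_def)
    qed
  qed
  have "\<exists>\<psi>\<in>tuple_cochains (charts r l) (coord_eq ` neg_coords r l e) (nat q).
      tuple_diff (charts r l) \<psi> = coeff_at e f" if "e \<in> exponents r l a" for e
  proof -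
    have "tuple_diff (charts r l) (coeff_at e f) = (\<lambda>_. 0)"
      by (simp add: df flip: coeff_at_tuple_diff)
    then show ?thesis
      using ex f that unfolding exact_at_def mem_cochains_iff
      by (simp add: nat_add_1_diff_1[simplified])
  qed
  then obtain \<psi> where \<psi>: "\<And>e. e \<in> exponents r l a \<Longrightarrow>
        \<psi> e \<in> tuple_cochains (charts r l) (coord_eq ` neg_coords r l e) (nat q)"
      "\<And>e. e \<in> exponents r l a \<Longrightarrow> tuple_diff (charts r l) (\<psi> e) = coeff_at e f"
    by metis
  define g where "g \<sigma> = (\<Sum>e\<in>E \<inter> exponents r l a. Poly_Mapping.single e (\<psi> e \<sigma>))" for \<sigma>
  have coeff: "coeff_at e g = (if e \<in> E \<inter> exponents r l a then \<psi> e else (\<lambda>_. 0))" for e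
    using \<open>finite E\<close>
    by (auto simp: coeff_at_def g_def fun_eq_iff lookup_sum lookup_single when_def sum.delta)
  show "\<exists>g\<in>cochains r l a (q - 1). tuple_diff (charts r l) g = f"
  proof
    show "g \<in> cochains r l a (q - 1)"
      using \<psi>(1) by (simp add: mem_cochains_iff coeff) (simp add: tuple_cochains_def)
    show "tuple_diff (charts r l) g = f"
    proof (rule coeff_at_eqI)
      fix e
      have "coeff_at e f = (\<lambda>_. 0)" if "e \<notin> E \<inter> exponents r l a"
        using f outside that unfolding mem_cochains_iff by blast
      then show "coeff_at e (tuple_diff (charts r l) g) = coeff_at e f"
        using \<psi>(2)[of e] by (cases "e \<in> E \<inter> exponents r l a") (simp_all add: coeff_at_tuple_diff coeff)
    qed
  qed
qed

section \<open>Signs of exponents in a given multidegree\<close>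

text \<open>A factor whose \<open>l k + 1\<close> coordinates are all negative has degree at most
  \<open>- (l k + 1)\<close>; one without negative coordinates has nonnegative degree. Fullness
  rules out mixed factors.\<close>

lemma fst_neg_coords:
  assumes e: "e \<in> exponents r l a" and full: "Sigma (fst ` neg_coords r l e) (\<lambda>k. {..l k}) \<subseteq> neg_coords r l e"
    and k: "k \<in> {1..r}"
  shows "k \<in> fst ` neg_coords r l e \<longleftrightarrow> a k < 0"
    and "a k < 0 \<Longrightarrow> a k < - int (l k)"
proof -
  have a: "a k = (\<Sum>i\<le>l k. Poly_Mapping.lookup e (k, i))"
    using e k by (simp add: exponents_def)
  have neg: "a k < - int (l k)" if "k \<in> fst ` neg_coords r l e"
  proof -
    have "a k \<le> (\<Sum>i\<le>l k. - 1)"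
      unfolding a
    proof (rule sum_mono)
      fix i assume "i \<in> {..l k}"
      then have "(k, i) \<in> neg_coords r l e"
        using that full by blast
      then show "Poly_Mapping.lookup e (k, i) \<le> - 1"
        by (simp add: neg_coords_def)
    qed
    then show ?thesis by simp
  qed
  moreover have "a k \<ge> 0" if "k \<notin> fst ` neg_coords r l e"
    unfolding a
  proof (rule sum_nonneg, rule ccontr)
    fix i assume "i \<in> {..l k}" "\<not> 0 \<le> Poly_Mapping.lookup e (k, i)"
    then have "(k, i) \<in> neg_coords r l e"
      using k by (simp add: neg_coords_def)
    then show False
      using that by force
  qed
  ultimately show "k \<in> fst ` neg_coords r l e \<longleftrightarrow> a k < 0" and "a k < 0 \<Longrightarrow> a k < - int (l k)"
    by linarith+
qed

lemma exists_exponent: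
  assumes "\<forall>k\<in>{1..r}. a k \<ge> 0 \<or> a k < - int (l k)"
  obtains e where "e \<in> exponents r l a"
    "Sigma (fst ` neg_coords r l e) (\<lambda>k. {..l k}) \<subseteq> neg_coords r l e"
proof -
  \<comment> \<open>Coordinate 0 absorbs the degree: the others get 0 when \<open>a k\<close> is
    nonnegative and -1 otherwise. In the second case coordinate 0 gets \<open>a k + l k\<close>,
    still negative by assumption.\<close>
  define v where "v = (\<lambda>(k, i). if a k \<ge> 0 then (if i = 0 then a k else 0)
    else if i = (0::nat) then a k + int (l k) else - 1)"
  define e where "e = (\<Sum>p\<in>(SIGMA k:{1..r}. {..l k}). Poly_Mapping.single p (v p))"
  have lookup: "Poly_Mapping.lookup e p = (if p \<in> (SIGMA k:{1..r}. {..l k}) then v p else 0)" for p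
    by (simp add: e_def lookup_sum lookup_single when_def sum.delta)
  have "(\<Sum>i\<le>l k. v (k, i)) = a k" for k
    unfolding v_def by (simp add: sum.atMost_shift)
  then have "(\<Sum>i\<le>l k. Poly_Mapping.lookup e (k, i)) = a k" if "k \<in> {1..r}" for k
    using that by (simp add: lookup)
  moreover have "Poly_Mapping.keys e \<subseteq> (SIGMA k:{1..r}. {..l k})"
    by (auto simp: in_keys_iff lookup split: if_splits)
  ultimately have "e \<in> exponents r l a"
    by (simp add: exponents_def)
  moreover have "p \<in> neg_coords r l e \<longleftrightarrow> p \<in> (SIGMA k:{1..r}. {..l k}) \<and> a (fst p) < 0" for p
    using assms by (force simp: neg_coords_def lookup v_def split: prod.splits if_splits)
  then have "Sigma (fst ` neg_coords r l e) (\<lambda>k. {..l k}) \<subseteq> neg_coords r l e"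
    by force
  ultimately show thesis by (rule that)
qed

text \<open>Only exponents with full negative factors violate exactness, and the degree in which
  they do depends on \<open>a\<close> alone. Whether such an exponent exists is decided by
  \<open>fst_neg_coords\<close> and \<open>exists_exponent\<close>.\<close>

lemma trivial_cohomology_iff:
  "trivial_group (cohomology r l q a :: ((nat \<Rightarrow> nat) list \<Rightarrow> 'k::field laurent) set monoid) \<longleftrightarrow>
    \<not> ((\<forall>k\<in>{1..r}. a k \<ge> 0 \<or> a k < - int (l k)) \<and> q = (\<Sum>k | k \<in> {1..r} \<and> a k < 0. int (l k)))"
proof -
  let ?full = "\<lambda>e. Sigma (fst ` neg_coords r l e) (\<lambda>k. {..l k}) \<subseteq> neg_coords r l e"
  have ex: "exact_at TYPE('k) (charts r l) (coord_eq ` neg_coords r l e) (nat (q + 1)) \<longleftrightarrow>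
      \<not> (?full e \<and> q = (\<Sum>k | k \<in> {1..r} \<and> a k < 0. int (l k)))" if "e \<in> exponents r l a" for e
  proof -
    have "exact_at TYPE('k) (charts r l) (coord_eq ` neg_coords r l e) (nat (q + 1)) \<longleftrightarrow>
        \<not> (?full e \<and> nat (q + 1) = Suc (\<Sum>k\<in>fst ` neg_coords r l e. card {..l k} - 1))"
      unfolding charts_def by (rule exact_at_box) (auto simp: neg_coords_def)
    also have "\<dots> \<longleftrightarrow> \<not> (?full e \<and> q = (\<Sum>k\<in>fst ` neg_coords r l e. int (l k)))"
      by (simp add: nat_eq_iff flip: of_nat_sum)
    also have "\<dots> \<longleftrightarrow> \<not> (?full e \<and> q = (\<Sum>k | k \<in> {1..r} \<and> a k < 0. int (l k)))"
    proof -
      have "fst ` neg_coords r l e = {k. k \<in> {1..r} \<and> a k < 0}" if "?full e"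
      proof -
        have "fst ` neg_coords r l e \<subseteq> {1..r}"
          by (auto simp: neg_coords_def)
        then show ?thesis
          using fst_neg_coords(1)[OF \<open>e \<in> exponents r l a\<close> that] by blast
      qed
      then show ?thesis by auto
    qed
    finally show ?thesis .
  qed
  have "(\<exists>e\<in>exponents r l a. ?full e) \<longleftrightarrow> (\<forall>k\<in>{1..r}. a k \<ge> 0 \<or> a k < - int (l k))"
    using fst_neg_coords(2)[of _ r l a] exists_exponent[of r a l] by (metis not_less)
  then show ?thesis
    unfolding trivial_cohomology_iff_exact_at using ex by blast
qed

section \<open>Covering an interval by intervals\<close>

text \<open>Equality in the union bound: an overlap, or a set smaller than its weight, would leave
  the union with fewer than \<open>sum w K\<close> elements.\<close>

lemma tight_cover:
  fixes I :: "'i \<Rightarrow> 'a set"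
  assumes "finite K" "\<And>k. k \<in> K \<Longrightarrow> finite (I k)" "\<And>k. k \<in> K \<Longrightarrow> card (I k) \<le> w k"
    and "sum w K \<le> card (\<Union>k\<in>K. I k)"
  shows "disjoint_family_on I K" and "\<And>k. k \<in> K \<Longrightarrow> card (I k) = w k"
proof -
  have le: "sum w K \<le> (\<Sum>k\<in>K. card (I k))"
    using card_UN_le[OF assms(1), of I] assms(4) by linarith
  show "card (I k) = w k" if "k \<in> K" for k
  proof (rule ccontr)
    assume "card (I k) \<noteq> w k"
    then have "(\<Sum>k\<in>K. card (I k)) < sum w K"
      using assms that by (intro sum_strict_mono_ex1) (auto intro!: bexI[of _ k] simp: le_neq_implies_less)
    then show False using le by simp
  qed
  show "disjoint_family_on I K"
    unfolding disjoint_family_on_def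
  proof (intro ballI impI, rule ccontr)
    fix j k assume jk: "j \<in> K" "k \<in> K" "j \<noteq> k" "I j \<inter> I k \<noteq> {}"
    then obtain x where x: "x \<in> I j" "x \<in> I k" by blast
    \<comment> \<open>The shared point \<open>x\<close> stays covered by \<open>I j\<close>, so
      deleting it from \<open>I k\<close> loses nothing and saves one in the count.\<close>
    have "(\<Union>k\<in>K. I k) = (I k - {x}) \<union> (\<Union>i\<in>K - {k}. I i)"
      using jk x by auto
    then have "card (\<Union>k\<in>K. I k) \<le> card (I k - {x}) + card (\<Union>i\<in>K - {k}. I i)"
      by (simp add: card_Un_le)
    also have "card (I k - {x}) < card (I k)"
      using assms jk x by (intro psubset_card_mono) auto
    also have "card (\<Union>i\<in>K - {k}. I i) \<le> (\<Sum>i\<in>K - {k}. card (I i))"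
      using assms by (intro card_UN_le) auto
    also have "\<dots> \<le> sum w (K - {k})"
      using assms by (intro sum_mono) auto
    also have "card (I k) + sum w (K - {k}) \<le> w k + sum w (K - {k})"
      using assms jk by simp
    also have "\<dots> = sum w K"
      using sum.remove[OF assms(1) jk(2), of w] by simp
    finally show False using assms(4) by simp
  qed
qed

text \<open>Good positions are the uncovered ones. From one to the next, \<open>s K p - p\<close>
  falls by at most one. It starts at 0 and may not be -1, 0 or 1, so it is at least 2 at every good
  position from 1 to \<open>n K\<close>, and cannot drop from there to -1 at
  \<open>n K + 1\<close>.\<close>

lemma no_good_position:
  fixes \<alpha> \<beta> :: "'i \<Rightarrow> int" and l :: "'i \<Rightarrow> nat"
  defines "good \<equiv> \<lambda>K p. \<forall>k\<in>K. p \<le> \<alpha> k \<or> \<beta> k < p"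
    and "s \<equiv> \<lambda>K p. \<Sum>k | k \<in> K \<and> \<alpha> k < p. int (l k)"
    and "n \<equiv> \<lambda>K. \<Sum>k\<in>K. int (l k)"
  assumes K: "finite K" and len: "\<And>k. k \<in> K \<Longrightarrow> \<alpha> k \<le> \<beta> k \<and> \<beta> k - \<alpha> k \<le> int (l k)"
    and bounds: "\<And>k. k \<in> K \<Longrightarrow> 0 \<le> \<alpha> k \<and> \<beta> k \<le> n K"
    and avoid: "\<And>p. 1 \<le> p \<Longrightarrow> p \<le> n K \<Longrightarrow> good K p \<Longrightarrow> s K p - p \<notin> {- 1, 0, 1}"
    and p: "1 \<le> p" "p \<le> n K"
  shows "\<not> good K p"
proof
  assume "good K p"
  have gap: "x' - x - 1 \<le> s K x' - s K x"
    if "good K x" "x < x'" and none: "\<And>y. x < y \<Longrightarrow> y < x' \<Longrightarrow> \<not> good K y" for x x'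
  proof -
    \<comment> \<open>As \<open>x\<close> is uncovered, an interval covering a point strictly
      between \<open>x\<close> and \<open>x'\<close> has its left end at or after \<open>x\<close>;
      the indices with left end in this range are exactly those that \<open>s\<close> gains.\<close>
    let ?J = "{k \<in> K. x \<le> \<alpha> k \<and> \<alpha> k < x'}"
    have "y \<in> (\<Union>k\<in>?J. {\<alpha> k<..\<beta> k})" if y: "y \<in> {x<..<x'}" for y
    proof -
      obtain k where "k \<in> K" "\<alpha> k < y" "y \<le> \<beta> k"
        using y none[of y] by (auto simp: good_def not_le not_less)
      then show ?thesis
        using y \<open>good K x\<close> by (force simp: good_def)
    qed
    then have "{x<..<x'} \<subseteq> (\<Union>k\<in>?J. {\<alpha> k<..\<beta> k})"
      by blast
    then have "card {x<..<x'} \<le> card (\<Union>k\<in>?J. {\<alpha> k<..\<beta> k})"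
      using K by (intro card_mono) auto
    also have "\<dots> \<le> (\<Sum>k\<in>?J. card {\<alpha> k<..\<beta> k})"
      using K by (intro card_UN_le) auto
    also have "\<dots> \<le> (\<Sum>k\<in>?J. l k)"
      using len by (intro sum_mono) force
    finally have "x' - x - 1 \<le> (\<Sum>k\<in>?J. int (l k))"
      using \<open>x < x'\<close> by (simp flip: of_nat_sum)
    moreover have "s K x' = s K x + (\<Sum>k\<in>?J. int (l k))"
      unfolding s_def using K \<open>x < x'\<close>
      by (subst sum.union_disjoint[symmetric]) (auto intro!: sum.cong)
    ultimately show ?thesis by simp
  qed
  have pred: "\<exists>x. 0 \<le> x \<and> x < x' \<and> good K x \<and> (\<forall>y. x < y \<longrightarrow> y < x' \<longrightarrow> \<not> good K y)"
    if "good K z" "0 \<le> z" "z < x'" for x' z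
  proof -
    let ?S = "{x \<in> {0..<x'}. good K x}"
    have "z \<in> ?S" "finite ?S"
      using that by (auto intro: finite_subset[of _ "{0..<x'}"])
    then obtain M where M: "M \<in> ?S" "\<And>y. y \<in> ?S \<Longrightarrow> y \<le> M"
      using Max_in[of ?S] Max_ge[of ?S] by blast
    have "\<not> good K y" if "M < y" "y < x'" for y
      using M(2)[of y] M(1) that by auto
    then show ?thesis
      using M(1) by auto
  qed
  have good0: "good K 0" "s K 0 = 0"
    using bounds by (fastforce simp: good_def s_def intro!: sum.neutral)+
  \<comment> \<open>The value at the previous good position is at least 0, so the next one is at
    least -1, and \<open>avoid\<close> lifts it to at least 2.\<close>
  have ge2: "s K x - x \<ge> 2" if "1 \<le> x" "x \<le> n K" "good K x" for x
    using that
  proof (induction "nat x" arbitrary: x rule: less_induct)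
    case less
    obtain y where y: "0 \<le> y" "y < x" "good K y" "\<forall>z. y < z \<longrightarrow> z < x \<longrightarrow> \<not> good K z"
      using pred[OF good0(1), of x] less.prems by auto
    then have "x - y - 1 \<le> s K x - s K y"
      by (intro gap) auto
    moreover have "s K y - y \<ge> 0"
      using less.hyps[of y] y less.prems good0 by (cases "y = 0") auto
    ultimately show ?case
      using avoid[OF less.prems] by auto
  qed
  \<comment> \<open>Here all intervals are counted, so the value is -1. The last good position
    before is at least \<open>p\<close>, hence has value at least 2, and a drop of one cannot bridge
    this.\<close>
  have "good K (n K + 1)" "s K (n K + 1) = n K"
  proof -
    show "good K (n K + 1)"
      using bounds by (force simp: good_def)
    have "{k. k \<in> K \<and> \<alpha> k < n K + 1} = K"
      using bounds len by force
    then show "s K (n K + 1) = n K"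
      by (simp add: s_def n_def)
  qed
  moreover obtain y where y: "0 \<le> y" "y < n K + 1" "good K y"
      "\<forall>z. y < z \<longrightarrow> z < n K + 1 \<longrightarrow> \<not> good K z"
    using pred[OF \<open>good K p\<close>, of "n K + 1"] p by auto
  moreover have "n K + 1 - y - 1 \<le> s K (n K + 1) - s K y"
    using y by (intro gap) auto
  moreover have "y \<ge> 1"
  proof -
    have "\<not> y < p"
      using y(4) \<open>good K p\<close> p by auto
    then show ?thesis using p by linarith
  qed
  ultimately show False
    using ge2[of y] by auto
qed

section \<open>Weyman complexes of pure Bezout type\<close>

lemma mult_le_iff_le_div:
  fixes p m d :: int
  assumes "d > 0"
  shows "p * d \<le> m \<longleftrightarrow> p \<le> m div d"
proof
  assume "p * d \<le> m"
  then have "p * d div d \<le> m div d"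
    using assms by (intro zdiv_mono1)
  then show "p \<le> m div d"
    using assms by simp
next
  assume "p \<le> m div d"
  then have "p * d \<le> m div d * d"
    using assms by (intro mult_right_mono) auto
  also have "\<dots> \<le> m"
    using assms by (simp add: minus_mod_eq_div_mult[symmetric])
  finally show "p * d \<le> m" .
qed

text \<open>In the application, \<open>\<alpha> k < p \<le> \<beta> k\<close> means that the
  \<open>k\<close>-th factor of the \<open>p\<close>-th summand has no cohomology at all. Otherwise
  the sum collects the top degrees of the factors of negative degree, and has to equal the
  cohomological degree \<open>p - \<nu>\<close>.\<close>

definition summand_nonzero :: "'i set \<Rightarrow> ('i \<Rightarrow> nat) \<Rightarrow> ('i \<Rightarrow> int) \<Rightarrow> ('i \<Rightarrow> int) \<Rightarrow> int \<Rightarrow> int \<Rightarrow> bool" where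
  "summand_nonzero K l \<alpha> \<beta> \<nu> p \<longleftrightarrow>
    (\<forall>k\<in>K. p \<le> \<alpha> k \<or> \<beta> k < p) \<and> p - \<nu> = (\<Sum>k | k \<in> K \<and> \<alpha> k < p. int (l k))"

lemma trivial_weyman_summand_iff:
  assumes "\<And>k. k \<in> {1..r} \<Longrightarrow> d k \<ge> 1"
  shows "trivial_group (weyman_summand r l d m \<nu> p :: ((nat \<Rightarrow> nat) list \<Rightarrow> 'k::field laurent) set monoid) \<longleftrightarrow>
    \<not> summand_nonzero {1..r} l (\<lambda>k. m k div int (d k)) (\<lambda>k. (m k + int (l k)) div int (d k)) \<nu> (int p)"
proof -
  have *: "0 \<le> m k - int p * int (d k) \<longleftrightarrow> int p \<le> m k div int (d k)"
    "m k - int p * int (d k) < - int (l k) \<longleftrightarrow> (m k + int (l k)) div int (d k) < int p"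
    "m k - int p * int (d k) < 0 \<longleftrightarrow> m k div int (d k) < int p" if "k \<in> {1..r}" for k
    using assms[OF that] mult_le_iff_le_div[of "int (d k)" "int p" "m k"]
      mult_le_iff_le_div[of "int (d k)" "int p" "m k + int (l k)"] by linarith+
  then have "{k. k \<in> {1..r} \<and> m k - int p * int (d k) < 0} =
      {k. k \<in> {1..r} \<and> m k div int (d k) < int p}"
    by blast
  then show ?thesis
    unfolding weyman_summand_def trivial_cohomology_iff summand_nonzero_def using * by simp
qed

text \<open>The binomial coefficients involved are positive, so each summand occurs at least once,
  with index \<open>(p, 0)\<close>.\<close>

lemma trivial_weyman_term_iff:
  "trivial_group (weyman_term r l d m \<nu> ::
      (nat \<times> nat \<Rightarrow> ((nat \<Rightarrow> nat) list \<Rightarrow> 'k::field laurent) set) monoid) \<longleftrightarrow>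
    (\<forall>p\<le>dim_X r l + 1. trivial_group (weyman_summand r l d m \<nu> p ::
      ((nat \<Rightarrow> nat) list \<Rightarrow> 'k laurent) set monoid))"
proof -
  have grp: "group ((case q of (p, i) \<Rightarrow> weyman_summand r l d m \<nu> p) ::
      ((nat \<Rightarrow> nat) list \<Rightarrow> 'k laurent) set monoid)" for q :: "nat \<times> nat"
    by (cases q) (simp add: weyman_summand_def group_cohomology)
  let ?I = "SIGMA p:{..dim_X r l + 1}. {..<(dim_X r l + 1) choose p}"
  have "fst ` ?I = {..dim_X r l + 1}"
  proof
    show "{..dim_X r l + 1} \<subseteq> fst ` ?I"
    proof
      fix p assume "p \<in> {..dim_X r l + 1}"
      then have "(p, 0) \<in> ?I"
        by simp
      then show "p \<in> fst ` ?I"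
        by (rule rev_image_eqI) simp
    qed
  qed auto
  moreover have "trivial_group (weyman_term r l d m \<nu> ::
      (nat \<times> nat \<Rightarrow> ((nat \<Rightarrow> nat) list \<Rightarrow> 'k::field laurent) set) monoid) \<longleftrightarrow>
      (\<forall>p\<in>fst ` ?I. trivial_group (weyman_summand r l d m \<nu> p ::
        ((nat \<Rightarrow> nat) list \<Rightarrow> 'k laurent) set monoid))"
    unfolding weyman_term_def trivial_group_sum_group[OF grp] ball_simps(9) by (simp add: case_prod_unfold)
  ultimately show ?thesis
    by (simp only: atMost_iff Ball_def)
qed

section \<open>Tilings, permutations and defects\<close>

text \<open>No position from 1 to \<open>n\<close> is uncovered, so intervals of total length at
  most \<open>n\<close> cover \<open>n\<close> points and hence tile them. The last claim reads off
  a right endpoint as the total length of the intervals up to it.\<close>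

lemma bezout_tiling:
  fixes \<alpha> \<beta> :: "'i \<Rightarrow> int" and l :: "'i \<Rightarrow> nat" and K :: "'i set"
  defines "n \<equiv> (\<Sum>k\<in>K. l k)"
  assumes K: "finite K" and "\<forall>k\<in>K. l k \<ge> 1"
    and "\<forall>k\<in>K. \<alpha> k \<le> \<beta> k \<and> \<beta> k - \<alpha> k \<le> int (l k)"
    and "\<forall>p\<le>n + 1. \<not> summand_nonzero K l \<alpha> \<beta> (- 1) (int p)"
    and "\<forall>p\<le>n + 1. p \<noteq> n + 1 \<longrightarrow> \<not> summand_nonzero K l \<alpha> \<beta> 1 (int p)"
    and top: "summand_nonzero K l \<alpha> \<beta> 1 (int (n + 1))"
    and "\<forall>p\<le>n + 1. p \<noteq> 0 \<longrightarrow> \<not> summand_nonzero K l \<alpha> \<beta> 0 (int p)"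
    and bot: "summand_nonzero K l \<alpha> \<beta> 0 (int 0)"
  shows "\<And>k. k \<in> K \<Longrightarrow> \<beta> k - \<alpha> k = int (l k)"
    and "inj_on \<beta> K"
    and "\<And>k. k \<in> K \<Longrightarrow> \<beta> k = (\<Sum>j | j \<in> K \<and> \<beta> j \<le> \<beta> k. int (l j))"
proof -
  note l = bspec[OF assms(3)] and len = bspec[OF assms(4)]
  have int_n: "int n = (\<Sum>k\<in>K. int (l k))"
    by (simp add: n_def)
  have alpha0: "0 \<le> \<alpha> k" if "k \<in> K" for k
  proof (rule ccontr)
    assume "\<not> 0 \<le> \<alpha> k"
    \<comment> \<open>At \<open>p = 0\<close> and \<open>\<nu> = 0\<close> the sum must vanish,
      whereas a negative \<open>\<alpha> k\<close> would contribute
      \<open>l k \<ge> 1\<close>.\<close>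
    then have "int (l k) \<le> (\<Sum>k | k \<in> K \<and> \<alpha> k < 0. int (l k))"
      using K that by (intro member_le_sum) auto
    then show False
      using bot l[OF that] by (simp add: summand_nonzero_def)
  qed
  have beta_n: "\<beta> k \<le> int n" if "k \<in> K" for k
  proof -
    \<comment> \<open>At \<open>p = n + 1\<close> and \<open>\<nu> = 1\<close> the sum must be all
      of \<open>n\<close>, so no factor may be missing from it.\<close>
    have "\<alpha> k < int (n + 1)"
    proof (rule ccontr)
      assume "\<not> \<alpha> k < int (n + 1)"
      then have "(\<Sum>k | k \<in> K \<and> \<alpha> k < int (n + 1). int (l k)) \<le> (\<Sum>k\<in>K - {k}. int (l k))"
        using K by (intro sum_mono2) auto
      also have "\<dots> = int n - int (l k)"
        unfolding int_n using K that by (simp add: sum_diff1)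
      finally show False
        using top l[OF that] by (simp add: summand_nonzero_def)
    qed
    moreover have "int (n + 1) \<le> \<alpha> k \<or> \<beta> k < int (n + 1)"
      using top that unfolding summand_nonzero_def by blast
    ultimately show ?thesis by auto
  qed
  have bad: "\<not> (\<forall>k\<in>K. p \<le> \<alpha> k \<or> \<beta> k < p)" if p: "1 \<le> p" "p \<le> int n" for p
  proof (rule no_good_position[OF K len])
    fix q :: int
    assume q: "1 \<le> q" "q \<le> (\<Sum>k\<in>K. int (l k))" "\<forall>k\<in>K. q \<le> \<alpha> k \<or> \<beta> k < q"
    let ?s = "\<Sum>k | k \<in> K \<and> \<alpha> k < q. int (l k)"
    have q': "q = int (nat q)" "nat q \<le> n + 1" "nat q \<noteq> 0" "nat q \<noteq> n + 1"
      using q int_n by auto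
    \<comment> \<open>An uncovered \<open>q\<close> gives a nonzero summand in the term of index
      \<open>q - ?s\<close>; strictly between 0 and \<open>n + 1\<close> the hypotheses forbid the
      indices -1, 0 and 1.\<close>
    have nz: "summand_nonzero K l \<alpha> \<beta> (q - ?s) (int (nat q))"
      using q by (simp add: summand_nonzero_def)
    have "q - ?s \<noteq> - 1"
      using nz assms(5) q' by metis
    moreover have "q - ?s \<noteq> 1"
      using nz assms(6) q' by metis
    moreover have "q - ?s \<noteq> 0"
      using nz assms(8) q' by metis
    ultimately show "?s - q \<notin> {- 1, 0, 1}"
      by auto
  qed (use alpha0 beta_n p int_n in auto)
  let ?I = "\<lambda>k. {\<alpha> k<..\<beta> k}"
  have in_cover: "\<exists>k\<in>K. p \<in> ?I k" if "1 \<le> p" "p \<le> int n" for p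
    using bad[OF that] by force
  have "{1..int n} \<subseteq> (\<Union>k\<in>K. ?I k)"
    using in_cover by auto
  then have "card {1..int n} \<le> card (\<Union>k\<in>K. ?I k)"
    using K by (intro card_mono) auto
  then have cov: "sum l K \<le> card (\<Union>k\<in>K. ?I k)"
    by (simp add: n_def del: of_nat_sum)
  have card_le: "card (?I k) \<le> l k" if "k \<in> K" for k
    using len[OF that] by (simp add: nat_le_iff)
  note tight = tight_cover[OF K _ card_le cov]
  have disj: "disjoint_family_on ?I K" and card_eq: "\<And>k. k \<in> K \<Longrightarrow> card (?I k) = l k"
    using tight by auto
  show len_eq: "\<beta> k - \<alpha> k = int (l k)" if "k \<in> K" for k
    using card_eq[OF that, simplified] len[OF that] by linarith
  have meet: "j = k" if "j \<in> K" "k \<in> K" "x \<in> ?I j" "x \<in> ?I k" for j k x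
    using disj that unfolding disjoint_family_on_def by blast
  have end_mem: "\<beta> k \<in> ?I k" if "k \<in> K" for k
    using len_eq[OF that] l[OF that] by simp
  show "inj_on \<beta> K"
    using meet end_mem by (intro inj_onI) metis
  show "\<beta> k = (\<Sum>j | j \<in> K \<and> \<beta> j \<le> \<beta> k. int (l j))" if k: "k \<in> K" for k
  proof -
    let ?J = "{j. j \<in> K \<and> \<beta> j \<le> \<beta> k}"
    have "{1..\<beta> k} = (\<Union>j\<in>?J. ?I j)"
    proof
      show "(\<Union>j\<in>?J. ?I j) \<subseteq> {1..\<beta> k}"
        using alpha0 by force
      show "{1..\<beta> k} \<subseteq> (\<Union>j\<in>?J. ?I j)"
      proof
        fix p assume p: "p \<in> {1..\<beta> k}"
        then obtain j where j: "j \<in> K" "p \<in> ?I j"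
          using in_cover beta_n[OF k] by force
        \<comment> \<open>An interval containing \<open>p\<close> and reaching beyond
          \<open>\<beta> k\<close> would contain \<open>\<beta> k\<close>, which belongs to the
          \<open>k\<close>-th interval.\<close>
        have "\<beta> j \<le> \<beta> k"
        proof (rule ccontr)
          assume "\<not> \<beta> j \<le> \<beta> k"
          then have "\<beta> k \<in> ?I j"
            using j p by auto
          then have "j = k"
            using meet j(1) k end_mem[OF k] by blast
          then show False using \<open>\<not> \<beta> j \<le> \<beta> k\<close> by simp
        qed
        then show "p \<in> (\<Union>j\<in>?J. ?I j)"
          using j by blast
      qed
    qed
    then have "card {1..\<beta> k} = card (\<Union>j\<in>?J. ?I j)"
      by simp
    also have "\<dots> = (\<Sum>j\<in>?J. card (?I j))"
      using K disj by (intro card_UN_disjoint) (auto simp: disjoint_family_on_def)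
    also have "\<dots> = (\<Sum>j\<in>?J. l j)"
      using card_eq by (intro sum.cong) auto
    finally have "nat (\<beta> k) = (\<Sum>j\<in>?J. l j)"
      by simp
    moreover have "0 \<le> \<beta> k"
      using alpha0[OF k] len[OF k] by linarith
    ultimately show ?thesis
      by (simp add: nat_eq_iff2 flip: of_nat_sum)
  qed
qed

text \<open>Ranking by the number of indices with \<open>\<beta>\<close> at least
  \<open>\<beta> k\<close> gives the rightmost interval rank 1. This reversal is the one built into
  \<open>m_perm\<close>, whose sum runs over \<open>\<pi> j \<ge> \<pi> k\<close>.\<close>

lemma exists_ranking:
  fixes \<beta> :: "nat \<Rightarrow> 'a::linorder"
  assumes "inj_on \<beta> {1..r}"
  shows "\<exists>\<pi>. \<pi> permutes {1..r} \<and> (\<forall>j\<in>{1..r}. \<forall>k\<in>{1..r}. \<pi> k \<le> \<pi> j \<longleftrightarrow> \<beta> j \<le> \<beta> k)"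
proof -
  define \<pi> where "\<pi> k = (if k \<in> {1..r} then card {j \<in> {1..r}. \<beta> k \<le> \<beta> j} else k)" for k
  have less: "\<pi> j < \<pi> k" if "j \<in> {1..r}" "k \<in> {1..r}" "\<beta> k < \<beta> j" for j k
  proof -
    have "{i \<in> {1..r}. \<beta> j \<le> \<beta> i} \<subset> {i \<in> {1..r}. \<beta> k \<le> \<beta> i}"
    proof (rule psubsetI)
      show "{i \<in> {1..r}. \<beta> j \<le> \<beta> i} \<subseteq> {i \<in> {1..r}. \<beta> k \<le> \<beta> i}"
        using \<open>\<beta> k < \<beta> j\<close> by auto
      have "k \<in> {i \<in> {1..r}. \<beta> k \<le> \<beta> i}" "k \<notin> {i \<in> {1..r}. \<beta> j \<le> \<beta> i}"
        using that by auto
      then show "{i \<in> {1..r}. \<beta> j \<le> \<beta> i} \<noteq> {i \<in> {1..r}. \<beta> k \<le> \<beta> i}"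
        by blast
    qed
    then show ?thesis
      using that by (simp add: \<pi>_def psubset_card_mono)
  qed
  have iff: "\<pi> k \<le> \<pi> j \<longleftrightarrow> \<beta> j \<le> \<beta> k" if "j \<in> {1..r}" "k \<in> {1..r}" for j k
  proof (cases "\<beta> j" "\<beta> k" rule: linorder_cases)
    case equal
    then have "j = k" using assms that by (auto dest: inj_onD)
    then show ?thesis by simp
  qed (use less[OF that] less[OF that(2,1)] in auto)
  have "inj_on \<pi> {1..r}"
  proof (rule inj_onI)
    fix j k assume jk: "j \<in> {1..r}" "k \<in> {1..r}" "\<pi> j = \<pi> k"
    then have "\<beta> j = \<beta> k"
      using iff[of j k] iff[of k j] by auto
    then show "j = k" using assms jk by (auto dest: inj_onD)
  qed
  moreover have "\<pi> ` {1..r} \<subseteq> {1..r}"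
  proof
    fix x assume "x \<in> \<pi> ` {1..r}"
    then obtain k where k: "k \<in> {1..r}" "x = card {j \<in> {1..r}. \<beta> k \<le> \<beta> j}"
      by (auto simp: \<pi>_def)
    have "card {j \<in> {1..r}. \<beta> k \<le> \<beta> j} \<le> card {1..r}"
      by (intro card_mono) auto
    moreover have "card {j \<in> {1..r}. \<beta> k \<le> \<beta> j} > 0"
      using k by (auto simp: card_gt_0_iff)
    ultimately show "x \<in> {1..r}"
      using k by simp
  qed
  ultimately have "bij_betw \<pi> {1..r} {1..r}"
    by (simp add: bij_betw_def endo_inj_surj)
  then have "\<pi> permutes {1..r}"
    by (rule bij_imp_permutes) (simp add: \<pi>_def del: atLeastAtMost_iff)
  then show ?thesis using iff by blast
qed

text \<open>The quotient is at most \<open>l k\<close>, so its ceiling is \<open>l k\<close> exactly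
  when it exceeds \<open>l k - 1\<close>; clearing the denominator leaves an inequality between
  integers.\<close>

lemma defect_eq_0_iff:
  assumes "l k \<ge> 1" "d k \<ge> 1"
  shows "defect l d k = 0 \<longleftrightarrow> (int (l k) - 1) * int (d k) < int (l k)"
proof -
  have "real (l k) / real (d k) \<le> real (l k)"
    using assms by (simp add: divide_le_eq mult_le_cancel_left1)
  then have "defect l d k = 0 \<longleftrightarrow> real (l k) - 1 < real (l k) / real (d k)"
    by (simp add: defect_def) (simp add: eq_commute[of "int (l k)"] ceiling_eq_iff)
  also have "\<dots> \<longleftrightarrow> (real (l k) - 1) * real (d k) < real (l k)"
    using assms by (simp add: less_divide_eq)
  also have "\<dots> \<longleftrightarrow> real_of_int ((int (l k) - 1) * int (d k)) < real_of_int (int (l k))"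
    by simp
  finally show ?thesis
    by (simp only: of_int_less_iff)
qed

lemma finite_argmax:
  fixes f :: "'i \<Rightarrow> nat"
  assumes "finite S" "S \<noteq> {}"
  shows "\<exists>k\<in>S. \<forall>j\<in>S. f j \<le> f k"
proof -
  have "Max (f ` S) \<in> f ` S"
    using assms by simp
  then obtain k where "k \<in> S" "f k = Max (f ` S)" by auto
  then show ?thesis
    using assms by (auto intro!: bexI[of _ k])
qed

lemma finite_argmin:
  fixes f :: "'i \<Rightarrow> nat"
  assumes "finite S" "S \<noteq> {}"
  shows "\<exists>k\<in>S. \<forall>j\<in>S. f k \<le> f j"
proof -
  have "Min (f ` S) \<in> f ` S"
    using assms by simp
  then obtain k where "k \<in> S" "f k = Min (f ` S)" by auto
  then show ?thesis
    using assms by (auto intro!: bexI[of _ k])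
qed

text \<open>Intervals of lengths \<open>l k\<close> laid side by side in order of decreasing
  \<open>\<pi>\<close> have right ends \<open>b k\<close>. They fill the positions from 1 to the
  total length, so only the two extreme values of \<open>p\<close> are uncovered; the sum is 0 at
  the first and the total length at the second, which determines \<open>\<nu>\<close>.\<close>

lemma permutation_tiling:
  fixes l \<pi> :: "nat \<Rightarrow> nat" and r :: nat
  defines "b \<equiv> \<lambda>k. \<Sum>j | j \<in> {1..r} \<and> \<pi> j \<ge> \<pi> k. int (l j)"
  assumes \<pi>: "\<pi> permutes {1..r}" and l: "\<And>k. k \<in> {1..r} \<Longrightarrow> l k \<ge> 1"
    and p: "0 \<le> p" "p \<le> (\<Sum>k=1..r. int (l k)) + 1"
  shows "summand_nonzero {1..r} l (\<lambda>k. b k - int (l k)) b \<nu> p \<longleftrightarrow>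
    p = 0 \<and> \<nu> = 0 \<or> p = (\<Sum>k=1..r. int (l k)) + 1 \<and> \<nu> = 1"
proof -
  let ?n = "\<Sum>k=1..r. int (l k)"
  have b_ge: "int (l k) \<le> b k" if "k \<in> {1..r}" for k
    unfolding b_def using that by (intro member_le_sum) auto
  have b_le: "b k \<le> ?n" for k
    unfolding b_def by (intro sum_mono2) auto
  have b_diff: "b k - int (l k) = (\<Sum>j | j \<in> {1..r} \<and> \<pi> j > \<pi> k. int (l j))" if "k \<in> {1..r}" for k
  proof -
    have "{j. j \<in> {1..r} \<and> \<pi> j \<ge> \<pi> k} = insert k {j. j \<in> {1..r} \<and> \<pi> j > \<pi> k}"
      using that permutes_inj[OF \<pi>] by (auto simp: le_less dest: injD)
    then show ?thesis
      by (simp add: b_def)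
  qed
  have covered: "\<exists>k\<in>{1..r}. b k - int (l k) < p \<and> p \<le> b k" if "1 \<le> p" "p \<le> ?n"
  proof -
    let ?S = "{k \<in> {1..r}. p \<le> b k}"
    have "?S \<noteq> {}"
    proof -
      have r: "{1..r} \<noteq> {}"
      proof
        assume "{1..r} = {}"
        then have "?n = 0" by (simp only: sum.empty)
        then show False using that by linarith
      qed
      obtain k where k: "k \<in> {1..r}" "\<And>j. j \<in> {1..r} \<Longrightarrow> \<pi> k \<le> \<pi> j"
        using finite_argmin[OF _ r, of \<pi>] by blast
      then have "{j. j \<in> {1..r} \<and> \<pi> j \<ge> \<pi> k} = {1..r}" by auto
      then have "b k = ?n" by (simp add: b_def)
      then show ?thesis using k that by auto
    qed
    then obtain k where k: "k \<in> ?S" "\<And>j. j \<in> ?S \<Longrightarrow> \<pi> j \<le> \<pi> k"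
      using finite_argmax[of ?S \<pi>] by auto
    \<comment> \<open>Otherwise the interval of the next larger \<open>\<pi>\<close> ends where the
      \<open>k\<close>-th one begins and still reaches \<open>p\<close>, contrary to the choice of
      \<open>k\<close>; if there is none, the left end is 0.\<close>
    have "b k - int (l k) < p"
    proof (rule ccontr)
      assume *: "\<not> b k - int (l k) < p"
      let ?T = "{j. j \<in> {1..r} \<and> \<pi> j > \<pi> k}"
      have "?T \<noteq> {}"
      proof
        assume "?T = {}"
        then have "b k - int (l k) = 0"
          using b_diff[of k] k(1) by (simp only: sum.empty) simp
        then show False using * \<open>1 \<le> p\<close> by linarith
      qed
      then obtain j where j: "j \<in> ?T" "\<And>i. i \<in> ?T \<Longrightarrow> \<pi> j \<le> \<pi> i"
        using finite_argmin[of ?T \<pi>] by auto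
      then have "{i. i \<in> {1..r} \<and> \<pi> i \<ge> \<pi> j} = ?T"
        by force
      then have "b j = b k - int (l k)"
        using b_diff[of k] k by (simp add: b_def)
      then show False
        using k(2)[of j] j * by auto
    qed
    then show ?thesis using k by auto
  qed
  have *: "(\<forall>k\<in>{1..r}. p \<le> b k - int (l k) \<or> b k < p) \<longleftrightarrow> p = 0 \<or> p = ?n + 1"
  proof
    assume "\<forall>k\<in>{1..r}. p \<le> b k - int (l k) \<or> b k < p"
    then show "p = 0 \<or> p = ?n + 1"
      using covered p by force
  next
    assume "p = 0 \<or> p = ?n + 1"
    then show "\<forall>k\<in>{1..r}. p \<le> b k - int (l k) \<or> b k < p"
      using b_ge b_le by fastforce
  qed
  have "{k. k \<in> {1..r} \<and> b k - int (l k) < 0} = {}"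
    using b_ge by force
  then have s0: "(\<Sum>k | k \<in> {1..r} \<and> b k - int (l k) < 0. int (l k)) = 0"
    by (simp only: sum.empty)
  have "b k - int (l k) < ?n + 1" for k
    using b_le[of k] by linarith
  then have "{k. k \<in> {1..r} \<and> b k - int (l k) < ?n + 1} = {1..r}"
    by blast
  then have s1: "(\<Sum>k | k \<in> {1..r} \<and> b k - int (l k) < ?n + 1. int (l k)) = ?n"
    by simp
  have "?n \<ge> 0" by (simp add: sum_nonneg)
  then show ?thesis
    unfolding summand_nonzero_def * using s0 s1 by auto
qed

lemma single_candidate:
  assumes "\<forall>p\<le>N. p \<noteq> a \<longrightarrow> \<not> P p" "a \<le> N"
  shows "\<not> (\<forall>p\<le>N. \<not> P p) \<longleftrightarrow> P a"
  using assms by blast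

section \<open>Purity and the vectors of permutations\<close>

text \<open>Once all summands but the designated one vanish, the term is nonzero exactly when that
  summand is. If such a vanishing condition fails, both sides are false.\<close>

lemma pure_bezout_iff:
  fixes r :: nat and l d :: "nat \<Rightarrow> nat" and m :: "nat \<Rightarrow> int"
  assumes d: "\<forall>k\<in>{1..r}. d k \<ge> 1"
  defines "nz \<equiv> summand_nonzero {1..r} l (\<lambda>k. m k div int (d k)) (\<lambda>k. (m k + int (l k)) div int (d k))"
    and "n \<equiv> \<Sum>k=1..r. l k"
  shows "pure_bezout_generically_surjective TYPE('k::field) r l d m \<longleftrightarrow>
    (\<forall>p\<le>n + 1. \<not> nz (- 1) (int p)) \<and>
    (\<forall>p\<le>n + 1. p \<noteq> n + 1 \<longrightarrow> \<not> nz 1 (int p)) \<and> nz 1 (int (n + 1)) \<and>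
    (\<forall>p\<le>n + 1. p \<noteq> 0 \<longrightarrow> \<not> nz 0 (int p)) \<and> nz 0 (int 0)"
proof -
  have n: "dim_X r l = n"
    by (simp add: dim_X_def n_def)
  have triv: "trivial_group (weyman_summand r l d m \<nu> p ::
      ((nat \<Rightarrow> nat) list \<Rightarrow> 'k laurent) set monoid) \<longleftrightarrow> \<not> nz \<nu> (int p)" for \<nu> p
    unfolding nz_def by (rule trivial_weyman_summand_iff) (use d in blast)
  let ?top = "\<forall>p\<le>n + 1. p \<noteq> n + 1 \<longrightarrow> \<not> nz 1 (int p)" and ?bot = "\<forall>p\<le>n + 1. p \<noteq> 0 \<longrightarrow> \<not> nz 0 (int p)"
  have pure: "pure_bezout_generically_surjective TYPE('k) r l d m \<longleftrightarrow>
      (\<forall>p\<le>n + 1. \<not> nz (- 1) (int p)) \<and> ?top \<and> \<not> (\<forall>p\<le>n + 1. \<not> nz 1 (int p)) \<and>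
      ?bot \<and> \<not> (\<forall>p\<le>n + 1. \<not> nz 0 (int p))"
    unfolding pure_bezout_generically_surjective_def weyman_term_reduces_to_def
      trivial_weyman_term_iff triv n ..
  have only_top: "\<not> (\<forall>p\<le>n + 1. \<not> nz 1 (int p)) \<longleftrightarrow> nz 1 (int (n + 1))" if ?top
    using single_candidate[OF that le_refl] .
  have only_bot: "\<not> (\<forall>p\<le>n + 1. \<not> nz 0 (int p)) \<longleftrightarrow> nz 0 (int 0)" if ?bot
    using single_candidate[OF that zero_le] .
  show ?thesis
  proof (cases "?top \<and> ?bot")
    case True
    show ?thesis
      unfolding pure only_top[OF True[THEN conjunct1]] only_bot[OF True[THEN conjunct2]] ..
  next
    case False
    then consider "\<not> ?top" | "\<not> ?bot" by blast
    then show ?thesis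
      by cases (simp_all only: pure simp_thms)
  qed
qed

theorem theorem6p7:
  fixes r :: nat and l d :: "nat \<Rightarrow> nat" and m :: "nat \<Rightarrow> int"
  assumes "r \<ge> 1"
    and "\<And>k. k \<in> {1..r} \<Longrightarrow> l k \<ge> 1"
    and "\<And>k. k \<in> {1..r} \<Longrightarrow> d k \<ge> 1"
  shows "pure_bezout_generically_surjective TYPE('k::{alg_closed_field, field_char_0}) r l d m \<longleftrightarrow>
    (\<exists>\<pi>. \<pi> permutes {1..r} \<and> (\<forall>k\<in>{1..r}. m k = m_perm r l d \<pi> k)) \<and>
    (\<forall>k\<in>{1..r}. defect l d k = 0)"
proof
  have d: "\<forall>k\<in>{1..r}. d k \<ge> 1"
    using assms(3) by blast
  let ?\<alpha> = "\<lambda>k. m k div int (d k)" and ?\<beta> = "\<lambda>k. (m k + int (l k)) div int (d k)"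
  assume "pure_bezout_generically_surjective TYPE('k) r l d m"
  note pure = this[unfolded pure_bezout_iff[OF d]]
  have alpha: "x \<le> ?\<alpha> k \<longleftrightarrow> x * int (d k) \<le> m k" if "k \<in> {1..r}" for k x
    using mult_le_iff_le_div[of "int (d k)" x "m k"] assms(3)[OF that] by simp
  have beta: "x \<le> ?\<beta> k \<longleftrightarrow> x * int (d k) \<le> m k + int (l k)" if "k \<in> {1..r}" for k x
    using mult_le_iff_le_div[of "int (d k)" x "m k + int (l k)"] assms(3)[OF that] by simp
  have len: "?\<alpha> k \<le> ?\<beta> k \<and> ?\<beta> k - ?\<alpha> k \<le> int (l k)" if "k \<in> {1..r}" for k
  proof
    show "?\<alpha> k \<le> ?\<beta> k"
      using assms(3)[OF that] by (intro zdiv_mono1) auto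
    \<comment> \<open>Here \<open>l k \<le> l k * d k\<close>, and adding \<open>l k * d k\<close>
      to the numerator raises the quotient by exactly \<open>l k\<close>.\<close>
    have "?\<beta> k \<le> (m k + int (l k) * int (d k)) div int (d k)"
      using mult_left_mono[of 1 "int (d k)" "int (l k)"] assms(3)[OF that] by (intro zdiv_mono1) auto
    then show "?\<beta> k - ?\<alpha> k \<le> int (l k)"
      using assms(3)[OF that] by simp
  qed
  have l': "\<forall>k\<in>{1..r}. l k \<ge> 1" and len': "\<forall>k\<in>{1..r}. ?\<alpha> k \<le> ?\<beta> k \<and> ?\<beta> k - ?\<alpha> k \<le> int (l k)"
    using assms(2) len by blast+
  note tiling = bezout_tiling[where K = "{1..r}" and l = l and \<alpha> = ?\<alpha> and \<beta> = ?\<beta>, OF finite_atLeastAtMost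
        l' len' pure[THEN conjunct1] pure[THEN conjunct2, THEN conjunct1]
        pure[THEN conjunct2, THEN conjunct2, THEN conjunct1]
        pure[THEN conjunct2, THEN conjunct2, THEN conjunct2, THEN conjunct1]
        pure[THEN conjunct2, THEN conjunct2, THEN conjunct2, THEN conjunct2]]
  note len_eq = tiling(1) and inj = tiling(2) and beta_eq = tiling(3)
  \<comment> \<open>With \<open>b\<close> the right end, the two integer parts give
    \<open>b * d k - l k \<le> m k < b * d k - (l k - 1) * d k\<close>. Hence
    \<open>(l k - 1) * d k < l k\<close>, which is zero defect; and since
    \<open>(l k - 1) * d k \<ge> l k - 1\<close>, the only value left for \<open>m k\<close> is
    \<open>b * d k - l k\<close>.\<close>
  have *: "(int (l k) - 1) * int (d k) < int (l k)" "m k + int (l k) = int (d k) * ?\<beta> k"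
    if k: "k \<in> {1..r}" for k
  proof -
    define b where "b = ?\<beta> k"
    have a: "?\<alpha> k = b - int (l k)"
      using len_eq[OF k] by (simp add: b_def)
    have 1: "b * int (d k) \<le> m k + int (l k)"
      using beta[OF k, of b] by (simp add: b_def)
    have "\<not> (b - int (l k) + 1) * int (d k) \<le> m k"
      using alpha[OF k, of "b - int (l k) + 1"] a by simp
    then have 2: "m k < b * int (d k) - (int (l k) - 1) * int (d k)"
      by (simp add: algebra_simps)
    show "(int (l k) - 1) * int (d k) < int (l k)"
      using 1 2 by linarith
    have "(int (l k) - 1) * 1 \<le> (int (l k) - 1) * int (d k)"
      using assms(2)[OF k] assms(3)[OF k] by (intro mult_left_mono) auto
    then show "m k + int (l k) = int (d k) * ?\<beta> k"
      using 1 2 unfolding b_def[symmetric] by (simp add: mult.commute)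
  qed
  obtain \<pi> where \<pi>: "\<pi> permutes {1..r}"
    "\<And>j k. j \<in> {1..r} \<Longrightarrow> k \<in> {1..r} \<Longrightarrow> \<pi> k \<le> \<pi> j \<longleftrightarrow> ?\<beta> j \<le> ?\<beta> k"
    using exists_ranking[OF inj] by blast
  have "m k = m_perm r l d \<pi> k" if k: "k \<in> {1..r}" for k
  proof -
    have "{j. j \<in> {1..r} \<and> \<pi> j \<ge> \<pi> k} = {j. j \<in> {1..r} \<and> ?\<beta> j \<le> ?\<beta> k}"
      using \<pi>(2) k by blast
    then show ?thesis
      using *(2)[OF k] beta_eq[OF k] by (simp add: m_perm_def)
  qed
  moreover have "defect l d k = 0" if k: "k \<in> {1..r}" for k
    using *(1)[OF k] defect_eq_0_iff[of l k d, OF assms(2)[OF k] assms(3)[OF k]] by simp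
  ultimately show "(\<exists>\<pi>. \<pi> permutes {1..r} \<and> (\<forall>k\<in>{1..r}. m k = m_perm r l d \<pi> k)) \<and>
    (\<forall>k\<in>{1..r}. defect l d k = 0)"
    using \<pi>(1) by blast
next
  assume *: "(\<exists>\<pi>. \<pi> permutes {1..r} \<and> (\<forall>k\<in>{1..r}. m k = m_perm r l d \<pi> k)) \<and>
    (\<forall>k\<in>{1..r}. defect l d k = 0)"
  have d: "\<forall>k\<in>{1..r}. d k \<ge> 1"
    using assms(3) by blast
  from * obtain \<pi> where \<pi>: "\<pi> permutes {1..r}" and m: "\<And>k. k \<in> {1..r} \<Longrightarrow> m k = m_perm r l d \<pi> k"
    and defect: "\<And>k. k \<in> {1..r} \<Longrightarrow> defect l d k = 0"
    by blast
  define b where "b k = (\<Sum>j | j \<in> {1..r} \<and> \<pi> j \<ge> \<pi> k. int (l j))" for k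
  have beta: "(m k + int (l k)) div int (d k) = b k" if k: "k \<in> {1..r}" for k
    using assms(3)[OF k] m[OF k] by (simp add: m_perm_def b_def)
  have alpha: "m k div int (d k) = b k - int (l k)" if k: "k \<in> {1..r}" for k
  proof -
    have d: "int (d k) > 0"
      using assms(3)[OF k] by simp
    have mk: "m k = b k * int (d k) - int (l k)"
      using m[OF k] by (simp add: m_perm_def b_def mult.commute)
    \<comment> \<open>\<open>d k \<ge> 1\<close> bounds the quotient from below by
      \<open>b k - l k\<close>, and zero defect bounds it from above.\<close>
    have "int (l k) * 1 \<le> int (l k) * int (d k)"
      using assms(3)[OF k] by (intro mult_left_mono) auto
    then have "(b k - int (l k)) * int (d k) \<le> m k"
      by (simp add: mk algebra_simps)
    moreover have "(int (l k) - 1) * int (d k) < int (l k)"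
      using defect_eq_0_iff[of l k d, OF assms(2)[OF k] assms(3)[OF k]] defect[OF k] by simp
    then have "\<not> (b k - int (l k) + 1) * int (d k) \<le> m k"
      by (simp add: mk algebra_simps)
    ultimately show ?thesis
      unfolding mult_le_iff_le_div[OF d] by linarith
  qed
  let ?n = "\<Sum>k=1..r. l k"
  have nz: "summand_nonzero {1..r} l (\<lambda>k. m k div int (d k)) (\<lambda>k. (m k + int (l k)) div int (d k)) \<nu> (int p)
      \<longleftrightarrow> p = 0 \<and> \<nu> = 0 \<or> p = ?n + 1 \<and> \<nu> = 1" if "p \<le> ?n + 1" for \<nu> p
  proof -
    have "{k. k \<in> {1..r} \<and> m k div int (d k) < int p} = {k. k \<in> {1..r} \<and> b k - int (l k) < int p}"
      using alpha by auto
    then have "summand_nonzero {1..r} l (\<lambda>k. m k div int (d k)) (\<lambda>k. (m k + int (l k)) div int (d k)) \<nu> (int p)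
        \<longleftrightarrow> summand_nonzero {1..r} l (\<lambda>k. b k - int (l k)) b \<nu> (int p)"
      unfolding summand_nonzero_def using alpha beta by simp
    also have "\<dots> \<longleftrightarrow> int p = 0 \<and> \<nu> = 0 \<or> int p = (\<Sum>k=1..r. int (l k)) + 1 \<and> \<nu> = 1"
      unfolding b_def using that by (intro permutation_tiling \<pi> assms(2)) (auto simp flip: of_nat_sum)
    also have "\<dots> \<longleftrightarrow> p = 0 \<and> \<nu> = 0 \<or> p = ?n + 1 \<and> \<nu> = 1"
      by (simp flip: of_nat_sum) linarith
    finally show ?thesis .
  qed
  show "pure_bezout_generically_surjective TYPE('k) r l d m"
    unfolding pure_bezout_iff[OF d] by (intro conjI allI impI; subst nz; simp)
qed

end
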